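(* Let $Z$ be a compact abelian group with Haar probability measure $\mu$ and let $d\ge1$ be an integer. For every anti-uniform function $g$ of level $d$ on $Z$ with $\|g\|_{U(d)}^*=1$, every integer $k\ge d-1$ and every $\delta>0$, the function $g$ can be written as $$g=\mathcal D_df+h,$$ where $$\|f\|_{2^k}\le 1/\delta,\qquad \|h\|_{2^k/(2^k-1)}\le\delta,\qquad \|f\|_{U(d)}\le1 .$$
   Context: All functions are real valued and measurable; $\|\cdot\|_p$ is the $L^p(\mu)$ norm; $\mathbb E$ denotes the integral with respect to $\mu$ (or a product of copies of $\mu$); $\langle f;g\rangle=\mathbb E_{x\in Z}f(x)g(x)$. $V_d=\{0,1\}^d$, $\widetilde V_d=V_d\setminus\{\vec0\}$, and $\vec\epsilon\cdot\vec t=\epsilon_1t_1+\dots+\epsilon_dt_d$ for $\vec\epsilon\in V_d$, $\vec t\in Z^d$. An exponent $1/0$ is read as $\infty$. Gowers norm: for $f\in L^{2^{d-1}}(\mu)$, $\|f\|_{U(d)}^{2^d}=\mathbb E_{x\in Z,\,\vec t\in Z^d}\prod_{\vec\epsilon\in V_d}f(x+\vec\epsilon\cdot\vec t)$ (the integral converges, and $\|f\|_{U(d)}\le\|f\|_{2^{d-1}}$; for $d=1$ it is only a seminorm). Dual function: for $f\in L^{2^{d-1}}(\mu)$, $\mathcal D_df(x)=\mathbb E_{\vec t\in Z^d}\prod_{\vec\epsilon\in\widetilde V_d}f(x+\vec\epsilon\cdot\vec t)$. Anti-uniform functions of level $d$: functions $g\in L^{2^{d-1}/(2^{d-1}-1)}(\mu)$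 such that $\|g\|_{U(d)}^*:=\sup\{|\langle g;f\rangle|\colon f\in L^{2^{d-1}}(\mu),\ \|f\|_{U(d)}\le1\}<+\infty$. *)

theory Defs
  imports "HOL-Probability.Probability"
begin

text \<open>
  The compact abelian group is a type of class \<open>topological_ab_group_add\<close> and \<open>t2_space\<close> with
  compact universe; it need not be metrizable. On a non-metrizable group an invariant Borel
  probability measure is the Haar measure only if it is Radon, so regularity is part of the
  definition (for finite Borel measures on a compact Hausdorff space, inner regularity on all
  Borel sets entails outer regularity by complementation).
\<close>

definition haar_prob :: "'a::{topological_ab_group_add, t2_space} measure \<Rightarrow> bool" where
  "haar_prob M \<longleftrightarrow>
     prob_space M \<and> sets M = sets borel \<and>
     (\<forall>a. distr M borel (\<lambda>x. a + x) = M) \<and>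
     (\<forall>A\<in>sets borel. emeasure M A = (SUP K\<in>{K. K \<subseteq> A \<and> compact K}. emeasure M K))"

text \<open>
  Exponents live in \<^typ>\<open>ennreal\<close>, where \<open>1 / 0 = \<infinity>\<close>; in particular
  \<open>2 ^ k / (2 ^ k - 1)\<close> is \<open>\<infinity>\<close> for \<open>k = 0\<close>. Only exponents \<open>p \<ge> 1\<close> are used, and
  \<open>Lp_norm\<close> is meaningful only for functions in \<open>mem_Lp\<close>.
\<close>

definition mem_Lp :: "'a measure \<Rightarrow> ennreal \<Rightarrow> ('a \<Rightarrow> real) \<Rightarrow> bool" where
  "mem_Lp M p f \<longleftrightarrow>
     f \<in> borel_measurable M \<and>
     (if p = \<infinity> then \<exists>C. AE x in M. \<bar>f x\<bar> \<le> C
      else integrable M (\<lambda>x. \<bar>f x\<bar> powr enn2real p))"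

definition Lp_norm :: "'a measure \<Rightarrow> ennreal \<Rightarrow> ('a \<Rightarrow> real) \<Rightarrow> real" where
  "Lp_norm M p f =
     (if p = \<infinity> then enn2real (esssup M (\<lambda>x. ennreal \<bar>f x\<bar>))
      else (\<integral>x. \<bar>f x\<bar> powr enn2real p \<partial>M) powr (1 / enn2real p))"

definition pairing :: "'a measure \<Rightarrow> ('a \<Rightarrow> real) \<Rightarrow> ('a \<Rightarrow> real) \<Rightarrow> real" where
  "pairing M f g = (\<integral>x. f x * g x \<partial>M)"

text \<open>The cube \<open>{0,1}\<^sup>d\<close>, with coordinates indexed by \<open>0, \<dots>, d - 1\<close>.\<close>

definition cube :: "nat \<Rightarrow> (nat \<Rightarrow> nat) set" where
  "cube d = ({..<d} \<rightarrow>\<^sub>E {0, 1})"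

definition cube_nz :: "nat \<Rightarrow> (nat \<Rightarrow> nat) set" where
  "cube_nz d = cube d - {\<lambda>i\<in>{..<d}. 0}"

definition cube_dot :: "nat \<Rightarrow> (nat \<Rightarrow> nat) \<Rightarrow> (nat \<Rightarrow> 'a) \<Rightarrow> 'a::ab_group_add" where
  "cube_dot d \<epsilon> t = (\<Sum>i<d. if \<epsilon> i = 1 then t i else 0)"

text \<open>
  The integrals over \<open>Z\<^sup>d\<close> and \<open>Z \<times> Z\<^sup>d\<close> use the completed product measures. If \<open>Z\<close> is not
  second countable, addition need not be measurable from the product of the Borel
  sigma-algebras to the Borel sigma-algebra. But every Borel set lies between two Baire sets of
  the same Haar measure, and addition is measurable for products of Baire sigma-algebras, so the
  integrands below are measurable with respect to the completions.
\<close>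

definition gowers_norm ::
  "'a::{topological_ab_group_add, t2_space} measure \<Rightarrow> nat \<Rightarrow> ('a \<Rightarrow> real) \<Rightarrow> real" where
  "gowers_norm M d f =
     root (2 ^ d)
       (\<integral>(x, t). (\<Prod>\<epsilon>\<in>cube d. f (x + cube_dot d \<epsilon> t))
          \<partial>completion (M \<Otimes>\<^sub>M (\<Pi>\<^sub>M i\<in>{..<d}. M)))"

definition dual_function ::
  "'a::{topological_ab_group_add, t2_space} measure \<Rightarrow> nat \<Rightarrow> ('a \<Rightarrow> real) \<Rightarrow> 'a \<Rightarrow> real" where
  "dual_function M d f x =
     (\<integral>t. (\<Prod>\<epsilon>\<in>cube_nz d. f (x + cube_dot d \<epsilon> t)) \<partial>completion (\<Pi>\<^sub>M i\<in>{..<d}. M))"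

definition gowers_dual_norm ::
  "'a::{topological_ab_group_add, t2_space} measure \<Rightarrow> nat \<Rightarrow> ('a \<Rightarrow> real) \<Rightarrow> ennreal" where
  "gowers_dual_norm M d g =
     (SUP f\<in>{f. mem_Lp M (2 ^ (d - 1)) f \<and> gowers_norm M d f \<le> 1}. ennreal \<bar>pairing M g f\<bar>)"

definition anti_uniform ::
  "'a::{topological_ab_group_add, t2_space} measure \<Rightarrow> nat \<Rightarrow> ('a \<Rightarrow> real) \<Rightarrow> bool" where
  "anti_uniform M d g \<longleftrightarrow>
     mem_Lp M (2 ^ (d - 1) / (2 ^ (d - 1) - 1)) g \<and> gowers_dual_norm M d g < \<infinity>"

end

theory Submission
  imports Defs
begin

text \<open>
  For \<open>k \<ge> 1\<close> and \<open>p = 2\<^sup>k\<close>, minimise the functional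
  \<open>\<parallel>f\<parallel>\<^bsub>U(d)\<^esub> ^ 2\<^sup>d / 2\<^sup>d + \<delta>\<^sup>p \<parallel>f\<parallel>\<^sub>p ^ p / p - \<langle>g; f\<rangle>\<close> over \<open>L\<^sup>p\<close>. It is convex by the
  Gowers-Cauchy-Schwarz inequality and uniformly convex because of the middle term, so minimising
  sequences converge in norm. The Euler-Lagrange equation at the minimiser is
  \<open>g = \<D>\<^sub>d f + \<delta>\<^sup>p f ^ (p - 1)\<close>, and testing it against \<open>f\<close> gives
  \<open>\<parallel>f\<parallel>\<^bsub>U(d)\<^esub> ^ 2\<^sup>d + \<delta>\<^sup>p \<parallel>f\<parallel>\<^sub>p ^ p = \<langle>g; f\<rangle> \<le> \<parallel>f\<parallel>\<^bsub>U(d)\<^esub>\<close>, which contains all three bounds.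

  On a group that is not second countable addition is measurable only for the Baire
  sigma-algebra, so the minimisation runs over Baire functions. This suffices because, by
  regularity of the Haar measure, every Borel set agrees with a Baire set up to a null set.
\<close>

section \<open>The Baire sigma-algebra of a compact group\<close>

text \<open>The case \<open>k = 0\<close> is set apart: it forces \<open>d = 1\<close>, and at
  \<open>p = 1\<close> the middle term is no longer uniformly convex. For \<open>k \<ge> 1\<close>
  the exponent \<open>p\<close> is an even integer, so along any line \<open>f + s u\<close> all
  three terms of the functional are polynomials in \<open>s\<close>, and the Euler-Lagrange equation
  is read off from the linear coefficients.

  The weight \<open>\<delta>^p\<close> is dictated by the remainder:
  \<open>h = \<delta>^p f^(p-1)\<close> has conjugate norm
  \<open>\<delta>^p \<parallel>f\<parallel>_p^(p-1)\<close>, which is at most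
  \<open>\<delta>\<close> as soon as \<open>\<parallel>f\<parallel>_p \<le> 1/\<delta>\<close>.

  The Gowers norm enters through its power \<open>2^d\<close>, a multilinear form on the diagonal.
  The Gowers-Cauchy-Schwarz inequality is used additively: a mixed cube integral is at most the
  average of the pure ones, and convexity follows by multilinear expansion. Convergence of the cube
  integrals comes from antipodal vertices, whose two points are independent and uniform.

  Only the functions inserted into cube integrals have to be Baire. The given \<open>g\<close> stays
  Borel, since it is only paired with Baire functions.\<close>

definition baire :: "'a::topological_space measure" where
  "baire = sigma UNIV {\<phi> -` U | (\<phi> :: 'a \<Rightarrow> real) U. continuous_on UNIV \<phi> \<and> open U}"

lemma space_baire [simp]: "space baire = UNIV"
  by (simp add: baire_def)

lemma continuous_imp_baire_measurable:
  fixes \<phi> :: "'a::topological_space \<Rightarrow> real"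
  assumes "continuous_on UNIV \<phi>"
  shows "\<phi> \<in> borel_measurable baire"
proof (rule borel_measurableI)
  fix S :: "real set"
  assume "open S"
  then have "\<phi> -` S \<in> sets baire"
    unfolding baire_def using assms by (subst sets_measure_of) auto
  then show "\<phi> -` S \<inter> space baire \<in> sets baire"
    by simp
qed

text \<open>The universal property of an initial sigma-algebra: measurability of a map such as
  addition can be checked after composing with one continuous function at a time.\<close>

lemma measurable_baireI:
  fixes u :: "'b \<Rightarrow> 'a::topological_space"
  assumes "\<And>\<phi> :: 'a \<Rightarrow> real. continuous_on UNIV \<phi> \<Longrightarrow> (\<lambda>z. \<phi> (u z)) \<in> borel_measurable N"
  shows "u \<in> N \<rightarrow>\<^sub>M baire"
  unfolding baire_def
proof (rule measurable_measure_of)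
  fix y assume "y \<in> {\<phi> -` U | (\<phi> :: 'a \<Rightarrow> real) U. continuous_on UNIV \<phi> \<and> open U}"
  then obtain \<phi> :: "'a \<Rightarrow> real" and U where y: "y = \<phi> -` U" "continuous_on UNIV \<phi>" "open U"
    by blast
  have "(\<lambda>z. \<phi> (u z)) -` U \<inter> space N \<in> sets N"
    using assms[OF y(2)] y(3) by (auto intro: measurable_sets)
  then show "u -` y \<inter> space N \<in> sets N"
    by (simp add: y(1) vimage_def)
qed auto

lemma measurable_ident_borel_baire: "(\<lambda>x. x) \<in> borel \<rightarrow>\<^sub>M baire"
  by (rule measurable_baireI) (rule borel_measurable_continuous_onI)

text \<open>A compact Hausdorff space is normal, so Urysohn's lemma supplies the function without
  any metric.\<close>

lemma continuous_separation:
  fixes K L :: "'a::t2_space set"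
  assumes "compact (UNIV :: 'a set)" "closed K" "closed L" "K \<inter> L = {}"
  obtains \<phi> :: "'a \<Rightarrow> real" where "continuous_on UNIV \<phi>" "\<And>x. x \<in> K \<Longrightarrow> \<phi> x = 1" "\<And>x. x \<in> L \<Longrightarrow> \<phi> x = 0"
proof -
  have "compact_space (euclidean :: 'a topology)"
    using assms(1) by (simp add: compact_space_def)
  moreover have "Hausdorff_space (euclidean :: 'a topology)"
    unfolding Hausdorff_space_def using hausdorff by (auto simp: disjnt_def)
  ultimately have "normal_space (euclidean :: 'a topology)"
    by (intro compact_Hausdorff_or_regular_imp_normal_space disjI1)
  then obtain \<phi> where "continuous_map (euclidean :: 'a topology) euclideanreal \<phi>" "\<phi> ` K \<subseteq> {1}" "\<phi> ` L \<subseteq> {0}"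
    using Urysohn_lemma_alt[of "euclidean :: 'a topology" K L 1 0] assms
    by (metis closed_closedin disjnt_def)
  then show ?thesis
    by (intro that[of \<phi>]) auto
qed

text \<open>
  Continuous functions on \<open>Z \<times> Z\<close> that are measurable for the product of the Baire
  sigma-algebras separate points, so Stone-Weierstrass makes every continuous function on
  \<open>Z \<times> Z\<close> measurable for it.
\<close>

lemma continuous_imp_baire_pair_measurable:
  fixes \<phi> :: "'a::t2_space \<times> 'a \<Rightarrow> real"
  assumes "compact (UNIV :: 'a set)" "continuous_on UNIV \<phi>"
  shows "\<phi> \<in> borel_measurable (baire \<Otimes>\<^sub>M baire)"
proof -
  define R :: "('a \<times> 'a \<Rightarrow> real) set"
    where "R = {h. continuous_on UNIV h \<and> h \<in> borel_measurable (baire \<Otimes>\<^sub>M baire)}"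
  interpret function_ring_on R UNIV
  proof
    show "compact (UNIV :: ('a \<times> 'a) set)"
      using compact_Times[OF assms(1) assms(1)] by simp
    fix x y :: "'a \<times> 'a"
    assume "x \<noteq> y"
    then consider "fst x \<noteq> fst y" | "snd x \<noteq> snd y"
      by (metis prod.expand)
    then show "\<exists>f\<in>R. f x \<noteq> f y"
    proof cases
      case 1
      obtain \<psi> :: "'a \<Rightarrow> real" where \<psi>: "continuous_on UNIV \<psi>" "\<And>z. z \<in> {fst x} \<Longrightarrow> \<psi> z = 1"
        "\<And>z. z \<in> {fst y} \<Longrightarrow> \<psi> z = 0"
        using continuous_separation[OF assms(1), of "{fst x}" "{fst y}"] 1 by auto
      have "(\<lambda>z. \<psi> (fst z)) \<in> R"
        unfolding R_def
        using continuous_on_compose2[OF \<psi>(1) continuous_on_fst[OF continuous_on_id]] continuous_imp_baire_measurable[OF \<psi>(1)]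
        by auto
      then show ?thesis
        using \<psi> by (intro bexI[of _ "\<lambda>z. \<psi> (fst z)"]) auto
    next
      case 2
      obtain \<psi> :: "'a \<Rightarrow> real" where \<psi>: "continuous_on UNIV \<psi>" "\<And>z. z \<in> {snd x} \<Longrightarrow> \<psi> z = 1"
        "\<And>z. z \<in> {snd y} \<Longrightarrow> \<psi> z = 0"
        using continuous_separation[OF assms(1), of "{snd x}" "{snd y}"] 2 by auto
      have "(\<lambda>z. \<psi> (snd z)) \<in> R"
        unfolding R_def
        using continuous_on_compose2[OF \<psi>(1) continuous_on_snd[OF continuous_on_id]] continuous_imp_baire_measurable[OF \<psi>(1)]
        by auto
      then show ?thesis
        using \<psi> by (intro bexI[of _ "\<lambda>z. \<psi> (snd z)"]) auto
    qed
  qed (auto simp: R_def intro!: continuous_intros)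
  have "\<exists>h\<in>R. \<forall>x\<in>UNIV. \<bar>\<phi> x - h x\<bar> < inverse (real (Suc n))" for n
    using Stone_Weierstrass_basic[OF assms(2)] by simp
  then obtain h where h: "\<And>n. h n \<in> R" "\<And>n x. \<bar>\<phi> x - h n x\<bar> < inverse (real (Suc n))"
    by (metis UNIV_I)
  have "(\<lambda>n. h n x) \<longlonglongrightarrow> \<phi> x" for x
  proof (rule LIMSEQ_I)
    fix r :: real assume "r > 0"
    then obtain N where "inverse (real (Suc N)) < r"
      using reals_Archimedean by blast
    moreover have "inverse (real (Suc n)) \<le> inverse (real (Suc N))" if "n \<ge> N" for n
      using that by (intro le_imp_inverse_le) auto
    ultimately have "norm (h n x - \<phi> x) < r" if "n \<ge> N" for n
      using h(2)[of x n] that by (smt (verit) real_norm_def)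
    then show "\<exists>N. \<forall>n\<ge>N. norm (h n x - \<phi> x) < r"
      by blast
  qed
  then show ?thesis
    by (rule borel_measurable_LIMSEQ_real) (use h(1) in \<open>auto simp: R_def\<close>)
qed

text \<open>For continuous \<open>\<phi>\<close> the map \<open>\<phi> (x + y)\<close> is continuous
  on the square, hence measurable for the product of the Baire sigma-algebras. For Borel sets the
  analogue may fail, which is why every function shifted along a cube below is Baire.\<close>

lemma measurable_baire_add:
  fixes u v :: "'b \<Rightarrow> 'a::{topological_ab_group_add, t2_space}"
  assumes "compact (UNIV :: 'a set)" and uv: "u \<in> N \<rightarrow>\<^sub>M baire" "v \<in> N \<rightarrow>\<^sub>M baire"
  shows "(\<lambda>z. u z + v z) \<in> N \<rightarrow>\<^sub>M baire"
proof (rule measurable_baireI)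
  fix \<phi> :: "'a \<Rightarrow> real"
  assume "continuous_on UNIV \<phi>"
  then have "continuous_on UNIV (\<lambda>z :: 'a \<times> 'a. \<phi> (fst z + snd z))"
    by (rule continuous_on_compose2) (auto intro!: continuous_intros)
  then have "(\<lambda>z :: 'a \<times> 'a. \<phi> (fst z + snd z)) \<in> borel_measurable (baire \<Otimes>\<^sub>M baire)"
    using assms(1) by (rule continuous_imp_baire_pair_measurable[rotated])
  from measurable_compose[OF measurable_Pair[OF uv] this]
  show "(\<lambda>z. \<phi> (u z + v z)) \<in> borel_measurable N"
    by simp
qed

section \<open>Translation invariance and Baire versions of Borel sets\<close>

locale compact_haar =
  fixes M :: "'a::{topological_ab_group_add, t2_space} measure"
  assumes compact_UNIV: "compact (UNIV :: 'a set)"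
    and haar: "haar_prob M"
begin

sublocale prob_space M
  using haar by (simp add: haar_prob_def)

sublocale PM: product_prob_space "\<lambda>_ :: nat. M" I for I
  by standard

lemma sets_M: "sets M = sets borel"
  using haar by (simp add: haar_prob_def)

lemma space_M [simp]: "space M = UNIV"
  using sets_eq_imp_space_eq[OF sets_M] by simp

lemma measurable_ident_baire: "(\<lambda>x. x) \<in> M \<rightarrow>\<^sub>M baire"
  using measurable_ident_borel_baire by (simp add: measurable_cong_sets[OF sets_M refl])

lemma baire_measurable_M: "f \<in> baire \<rightarrow>\<^sub>M N \<Longrightarrow> f \<in> M \<rightarrow>\<^sub>M N"
  by (drule measurable_compose[OF measurable_ident_baire]) simp

lemma measurable_M_baire: "u \<in> N \<rightarrow>\<^sub>M M \<Longrightarrow> u \<in> N \<rightarrow>\<^sub>M baire"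
  by (drule measurable_compose[OF _ measurable_ident_baire])

lemma baire_add:
  "u \<in> N \<rightarrow>\<^sub>M baire \<Longrightarrow> v \<in> N \<rightarrow>\<^sub>M baire \<Longrightarrow> (\<lambda>z. u z + v z :: 'a) \<in> N \<rightarrow>\<^sub>M baire"
  by (rule measurable_baire_add[OF compact_UNIV])

lemma distr_translate: "distr M M (\<lambda>x. a + x) = M"
  using haar distr_cong[OF refl sets_M, of M "\<lambda>x. a + x" "\<lambda>x. a + x"] by (simp add: haar_prob_def)

lemma nn_integral_translate:
  assumes "f \<in> borel_measurable M"
  shows "(\<integral>\<^sup>+x. f (a + x) \<partial>M) = (\<integral>\<^sup>+x. f x \<partial>M)"
proof -
  have "(\<lambda>x. a + x) \<in> M \<rightarrow>\<^sub>M M"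
    by (simp add: measurable_cong_sets[OF sets_M sets_M] borel_measurable_continuous_onI continuous_intros)
  then have "integral\<^sup>N (distr M M (\<lambda>x. a + x)) f = (\<integral>\<^sup>+x. f (a + x) \<partial>M)"
    using assms by (intro nn_integral_distr) auto
  then show ?thesis
    by (simp add: distr_translate)
qed

lemma integral_translate:
  fixes f :: "'a \<Rightarrow> real"
  assumes "f \<in> borel_measurable M"
  shows "(\<integral>x. f (a + x) \<partial>M) = (\<integral>x. f x \<partial>M)"
proof -
  have "(\<lambda>x. a + x) \<in> M \<rightarrow>\<^sub>M M"
    by (simp add: measurable_cong_sets[OF sets_M sets_M] borel_measurable_continuous_onI continuous_intros)
  then have "integral\<^sup>L (distr M M (\<lambda>x. a + x)) f = (\<integral>x. f (a + x) \<partial>M)"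
    using assms by (intro integral_distr)
  then show ?thesis
    by (simp add: distr_translate)
qed

text \<open>
  Inner regularity of \<open>A\<close> and of its complement gives compact sets exhausting both up to null
  sets; the Baire set is built from functions separating these compact sets.
\<close>

lemma borel_set_AE_baire_set:
  assumes "A \<in> sets M"
  obtains B where "B \<in> sets baire" "AE x in M. x \<in> A \<longleftrightarrow> x \<in> B"
proof -
  have exhaust: "\<exists>K :: nat \<Rightarrow> 'a set. (\<forall>n. K n \<subseteq> A \<and> compact (K n)) \<and> (AE x in M. x \<in> A \<longrightarrow> (\<exists>n. x \<in> K n))"
    if A: "A \<in> sets M" for A
  proof -
    have eq: "emeasure M A = (SUP K\<in>{K. K \<subseteq> A \<and> compact K}. emeasure M K)"
      using haar A unfolding haar_prob_def by auto
    \<comment> \<open>Sets of small measure are treated apart, with empty \<open>K\<close>: for them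
      the difference in the other case would be negative and \<open>ennreal\<close> would send it to
      0, so that the strict inequality could fail for null sets.\<close>
    have "\<exists>K. K \<subseteq> A \<and> compact K \<and> measure M (A - K) < inverse (real (Suc n))" for n
    proof (cases "measure M A < inverse (real (Suc n))")
      case True
      then show ?thesis by (intro exI[of _ "{}"]) auto
    next
      case False
      then have "ennreal (measure M A - inverse (real (Suc n))) < emeasure M A"
        by (simp add: emeasure_eq_measure ennreal_less_iff)
      then obtain K where K: "K \<subseteq> A" "compact K"
          "ennreal (measure M A - inverse (real (Suc n))) < emeasure M K"
        unfolding eq less_SUP_iff by blast
      have "K \<in> sets M"
        using K(2) by (simp add: sets_M compact_imp_closed)
      then have "measure M (A - K) < inverse (real (Suc n))"
        using K(3) A K(1) False by (simp add: finite_measure_Diff emeasure_eq_measure ennreal_less_iff)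
      then show ?thesis using K by blast
    qed
    then obtain K where K: "\<And>n. K n \<subseteq> A" "\<And>n. compact (K n)"
        "\<And>n. measure M (A - K n) < inverse (real (Suc n))"
      by metis
    have sK [measurable]: "K n \<in> sets M" for n
      using K(2) by (simp add: sets_M compact_imp_closed)
    have "measure M (A - (\<Union>n. K n)) \<le> inverse (real (Suc n))" for n
      using K(3)[of n] finite_measure_mono[of "A - (\<Union>n. K n)" "A - K n"] A by fastforce
    then have "measure M (A - (\<Union>n. K n)) \<le> 0"
      by (intro LIMSEQ_le_const[OF LIMSEQ_inverse_real_of_nat]) auto
    then have "emeasure M (A - (\<Union>n. K n)) = 0"
      by (simp add: emeasure_eq_measure measure_le_0_iff)
    then have "AE x in M. x \<notin> A - (\<Union>n. K n)"
      using A by (subst (asm) AE_iff_measurable[symmetric, of _ _ "\<lambda>x. x \<notin> A - (\<Union>n. K n)"]) auto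
    then have "AE x in M. x \<in> A \<longrightarrow> (\<exists>n. x \<in> K n)"
      by (rule eventually_mono) auto
    then show ?thesis
      using K(1,2) by (intro exI[of _ K] conjI allI)
  qed
  obtain K :: "nat \<Rightarrow> 'a set" where K: "\<And>n. K n \<subseteq> A" "\<And>n. compact (K n)" "AE x in M. x \<in> A \<longrightarrow> (\<exists>n. x \<in> K n)"
    using exhaust[OF assms] by blast
  obtain L :: "nat \<Rightarrow> 'a set" where L: "\<And>n. L n \<subseteq> - A" "\<And>n. compact (L n)" "AE x in M. x \<in> - A \<longrightarrow> (\<exists>n. x \<in> L n)"
  proof -
    have "- A \<in> sets M"
      using assms by (simp add: sets_M)
    from exhaust[OF this] show ?thesis
      using that by blast
  qed
  have "\<exists>\<phi> :: 'a \<Rightarrow> real. continuous_on UNIV \<phi> \<and> (\<forall>x\<in>K i. \<phi> x = 1) \<and> (\<forall>x\<in>L j. \<phi> x = 0)" for i j :: nat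
  proof -
    have "K i \<inter> L j = {}"
      using K(1)[of i] L(1)[of j] by auto
    from continuous_separation[OF compact_UNIV compact_imp_closed[OF K(2)] compact_imp_closed[OF L(2)] this]
    show ?thesis by metis
  qed
  then obtain \<phi> :: "nat \<Rightarrow> nat \<Rightarrow> 'a \<Rightarrow> real" where \<phi>: "\<And>i j. continuous_on UNIV (\<phi> i j)"
      "\<And>i j x. x \<in> K i \<Longrightarrow> \<phi> i j x = 1" "\<And>i j x. x \<in> L j \<Longrightarrow> \<phi> i j x = 0"
    by metis
  have [measurable]: "\<phi> i j \<in> borel_measurable baire" for i j
    using \<phi>(1) by (rule continuous_imp_baire_measurable)
  \<comment> \<open>On \<open>K i\<close> all \<open>\<phi> i j\<close> equal 1, and on
    \<open>L j\<close> all of them vanish. This order of quantifiers therefore puts every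
    \<open>K i\<close> inside \<open>B\<close> and every \<open>L j\<close> outside, using only
    countably many continuous functions.\<close>
  define B where "B = {x \<in> space baire. \<exists>i. \<forall>j. \<phi> i j x > 0}"
  show ?thesis
  proof
    show "B \<in> sets baire"
      unfolding B_def by measurable
    show "AE x in M. x \<in> A \<longleftrightarrow> x \<in> B"
      using K(3) L(3)
    proof eventually_elim
      case (elim x)
      show ?case
      proof (cases "x \<in> A")
        case True
        with elim(1) obtain i where "x \<in> K i" by blast
        then have "\<forall>j. \<phi> i j x > 0"
          using \<phi>(2) by simp
        with True show ?thesis
          by (auto simp: B_def)
      next
        case False
        with elim(2) obtain j where "x \<in> L j" by blast
        then have "\<not> \<phi> i j x > 0" for i
          using \<phi>(3) by simp
        with False show ?thesis
          by (auto simp: B_def)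
      qed
    qed
  qed

qed

text \<open>Up to null sets the Borel indicators are Baire indicators, so \<open>w\<close> is
  orthogonal to the set where it is positive as well. This turns an Euler-Lagrange equation tested
  against Baire functions into an identity almost everywhere, although \<open>w\<close> need only be
  Borel.\<close>

lemma AE_eq_0_if_baire_orthogonal:
  fixes w :: "'a \<Rightarrow> real"
  assumes w [measurable]: "integrable M w"
    and orth: "\<And>B. B \<in> sets baire \<Longrightarrow> (\<integral>x. w x * indicator B x \<partial>M) = 0"
  shows "AE x in M. w x = 0"
proof -
  have orth': "(\<integral>x. w x * indicator A x \<partial>M) = 0" if A [measurable]: "A \<in> sets M" for A
  proof -
    obtain B where B: "B \<in> sets baire" "AE x in M. x \<in> A \<longleftrightarrow> x \<in> B"
      using borel_set_AE_baire_set[OF A] by blast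
    have [measurable]: "B \<in> sets M"
      using measurable_sets[OF measurable_ident_baire B(1)] by simp
    have "(\<integral>x. w x * indicator A x \<partial>M) = (\<integral>x. w x * indicator B x \<partial>M)"
      using B(2) by (intro integral_cong_AE) (auto elim!: eventually_mono simp: indicator_def)
    then show ?thesis
      using orth[OF B(1)] by simp
  qed
  define P where "P = {x \<in> space M. w x > 0}"
  have [measurable]: "P \<in> sets M"
    unfolding P_def by measurable
  have wP: "integrable M (\<lambda>x. w x * indicator P x)"
    using integrable_real_mult_indicator[OF _ w] by simp
  have "(\<integral>x. \<bar>w x\<bar> \<partial>M) = (\<integral>x. 2 * (w x * indicator P x) - w x \<partial>M)"
    by (intro Bochner_Integration.integral_cong) (auto simp: P_def indicator_def)
  also have "\<dots> = 2 * (\<integral>x. w x * indicator P x \<partial>M) - (\<integral>x. w x \<partial>M)"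
    using w wP by simp
  also have "\<dots> = 0"
    using orth'[of P] orth'[of UNIV] sets.top[of M] by simp
  finally have "(\<integral>x. \<bar>w x\<bar> \<partial>M) = 0" .
  moreover have "integrable M (\<lambda>x. \<bar>w x\<bar>)"
    using w by (rule integrable_abs)
  ultimately have "AE x in M. \<bar>w x\<bar> = 0"
    using integral_nonneg_eq_0_iff_AE[of M "\<lambda>x. \<bar>w x\<bar>"] by simp
  then show ?thesis
    by simp
qed

end

section \<open>Cube integrals\<close>

lemma finite_cube [simp]: "finite (cube d)"
  unfolding cube_def by (intro finite_PiE) auto

lemma card_cube: "card (cube d) = 2 ^ d"
  unfolding cube_def by (simp add: card_PiE numeral_2_eq_2)

lemma cube_update: "\<epsilon> \<in> cube d \<Longrightarrow> i < d \<Longrightarrow> b \<in> {0, 1} \<Longrightarrow> \<epsilon>(i := b) \<in> cube d"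
  unfolding cube_def by (auto simp: PiE_iff extensional_def)

lemma cube_values: "\<epsilon> \<in> cube d \<Longrightarrow> i < d \<Longrightarrow> \<epsilon> i = 0 \<or> \<epsilon> i = 1"
  unfolding cube_def by (auto simp: PiE_iff)

lemma cube_dot_upd_0: "\<epsilon> i \<noteq> 1 \<Longrightarrow> cube_dot d \<epsilon> (t(i := s)) = cube_dot d \<epsilon> t"
  unfolding cube_dot_def by (intro sum.cong) auto

lemma cube_dot_upd_1:
  assumes "i < d" "\<epsilon> i \<noteq> 1"
  shows "cube_dot d (\<epsilon>(i := 1)) (t(i := s)) = cube_dot d \<epsilon> t + s"
proof -
  have "cube_dot d (\<epsilon>(i := 1)) (t(i := s)) = (if (\<epsilon>(i := 1)) i = 1 then (t(i := s)) i else 0) +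
      (\<Sum>j\<in>{..<d} - {i}. if (\<epsilon>(i := 1)) j = 1 then (t(i := s)) j else 0)"
    unfolding cube_dot_def using assms by (intro sum.remove) auto
  also have "\<dots> = s + (\<Sum>j\<in>{..<d} - {i}. if \<epsilon> j = 1 then t j else 0)"
    by (intro arg_cong2[of _ _ _ _ "(+)"] sum.cong) auto
  finally have "cube_dot d (\<epsilon>(i := 1)) (t(i := s)) = s + (\<Sum>j\<in>{..<d} - {i}. if \<epsilon> j = 1 then t j else 0)" .
  moreover have "cube_dot d \<epsilon> t = (\<Sum>j\<in>{..<d} - {i}. if \<epsilon> j = 1 then t j else 0)"
    unfolding cube_dot_def using assms by (subst sum.remove[of _ i]) auto
  ultimately show ?thesis
    by (simp add: add.commute)
qed

abbreviation origin :: "nat \<Rightarrow> nat \<Rightarrow> nat" where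
  "origin d \<equiv> \<lambda>i\<in>{..<d}. 0"

lemma origin_cube: "origin d \<in> cube d"
  unfolding cube_def by auto

lemma cube_dot_origin: "cube_dot d (origin d) t = 0"
  unfolding cube_dot_def by simp

definition cube_flip :: "nat \<Rightarrow> (nat \<Rightarrow> nat) \<Rightarrow> nat \<Rightarrow> nat" where
  "cube_flip i \<epsilon> = \<epsilon>(i := 1 - \<epsilon> i)"

lemma cube_flip_cube: "\<epsilon> \<in> cube d \<Longrightarrow> i < d \<Longrightarrow> cube_flip i \<epsilon> \<in> cube d"
  unfolding cube_flip_def using cube_values[of \<epsilon> d i] by (intro cube_update) auto

lemma cube_flip_flip: "\<epsilon> \<in> cube d \<Longrightarrow> i < d \<Longrightarrow> cube_flip i (cube_flip i \<epsilon>) = \<epsilon>"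
  unfolding cube_flip_def using cube_values[of \<epsilon> d i] by auto

text \<open>Of two antipodal vertices exactly one involves a given coordinate \<open>t i\<close>.
  Their two points are therefore independent and uniform, which makes the pair the natural unit for
  estimating a product over the cube.\<close>

definition antipode :: "nat \<Rightarrow> (nat \<Rightarrow> nat) \<Rightarrow> nat \<Rightarrow> nat" where
  "antipode d \<epsilon> = (\<lambda>i\<in>{..<d}. 1 - \<epsilon> i)"

lemma antipode_cube [simp]: "antipode d \<epsilon> \<in> cube d" if "\<epsilon> \<in> cube d"
  using that unfolding cube_def antipode_def by (auto simp: PiE_iff)

lemma antipode_antipode: "\<epsilon> \<in> cube d \<Longrightarrow> antipode d (antipode d \<epsilon>) = \<epsilon>"
  unfolding antipode_def cube_def by (rule ext) (force simp: PiE_iff extensional_def)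

text \<open>The square of the left side is the product of the antipodal pair products.\<close>

lemma prod_cube_le_sum_antipodal:
  fixes a :: "(nat \<Rightarrow> nat) \<Rightarrow> real"
  assumes d: "d \<ge> 1" and a: "\<And>\<epsilon>. \<epsilon> \<in> cube d \<Longrightarrow> a \<epsilon> \<ge> 0"
  shows "(\<Prod>\<epsilon>\<in>cube d. a \<epsilon>) \<le> (\<Sum>\<epsilon>\<in>cube d. (a \<epsilon> * a (antipode d \<epsilon>)) ^ (2 ^ (d - 1)))"
proof -
  define b where "b \<epsilon> = a \<epsilon> * a (antipode d \<epsilon>)" for \<epsilon>
  have b: "b \<epsilon> \<ge> 0" if "\<epsilon> \<in> cube d" for \<epsilon>
    using that a by (simp add: b_def)
  have ne: "cube d \<noteq> {}"
    using card_cube[of d] by (metis card.empty power_not_zero zero_neq_numeral)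
  \<comment> \<open>Bounding every pair by the largest one and then the largest by the sum costs a
    factor depending only on \<open>d\<close>. This is harmless, as the bound serves integrability
    and limits equal to 0.\<close>
  define m where "m = Max (b ` cube d)"
  have "m \<in> b ` cube d"
    unfolding m_def using ne by (intro Max_in) auto
  then obtain \<eta> where \<eta>: "\<eta> \<in> cube d" "m = b \<eta>"
    by auto
  have "(\<Prod>\<epsilon>\<in>cube d. a (antipode d \<epsilon>)) = (\<Prod>\<epsilon>\<in>cube d. a \<epsilon>)"
    by (rule prod.reindex_bij_witness[of _ "antipode d" "antipode d"]) (auto simp: antipode_antipode)
  then have "(\<Prod>\<epsilon>\<in>cube d. a \<epsilon>)\<^sup>2 = (\<Prod>\<epsilon>\<in>cube d. b \<epsilon>)"
    by (simp add: b_def prod.distrib power2_eq_square)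
  also have "\<dots> \<le> (\<Prod>\<epsilon>\<in>cube d. m)"
    unfolding m_def using b by (intro prod_mono) auto
  also have "\<dots> = (m ^ 2 ^ (d - 1))\<^sup>2"
    using d by (simp add: card_cube flip: power_mult power_Suc2)
  finally have "(\<Prod>\<epsilon>\<in>cube d. a \<epsilon>) \<le> m ^ 2 ^ (d - 1)"
    by (rule power2_le_imp_le) (use \<eta> b in auto)
  also have "\<dots> \<le> (\<Sum>\<epsilon>\<in>cube d. b \<epsilon> ^ 2 ^ (d - 1))"
    unfolding \<eta>(2) using b \<eta>(1) by (intro member_le_sum) auto
  finally show ?thesis
    by (simp add: b_def)
qed

text \<open>The pointwise source of the inclusion of the spaces with larger exponent in those with
  smaller exponent over a probability space.\<close>

lemma power_le_1_plus_power:
  fixes a :: real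
  assumes "a \<ge> 0" "n \<le> m"
  shows "a ^ n \<le> 1 + a ^ m"
proof (cases "a \<le> 1")
  case True
  then have "a ^ n \<le> 1" using assms by (simp add: power_le_one)
  then show ?thesis using assms by (simp add: add_increasing2)
next
  case False
  then have "a ^ n \<le> a ^ m" using assms by (intro power_increasing) auto
  then show ?thesis by simp
qed

text \<open>Plays the part of Hoelder's inequality for the mixed terms of a binomial
  expansion.\<close>

lemma power_mult_power_le:
  fixes a b :: real
  assumes "a \<ge> 0" "b \<ge> 0" "j \<le> n"
  shows "a ^ j * b ^ (n - j) \<le> a ^ n + b ^ n"
proof -
  have "a ^ j * b ^ (n - j) \<le> max a b ^ j * max a b ^ (n - j)"
    using assms by (intro mult_mono power_mono) auto
  also have "\<dots> = max a b ^ n"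
    using assms by (simp flip: power_add)
  also have "\<dots> \<le> a ^ n + b ^ n"
    using assms by (auto simp: max_def)
  finally show ?thesis .
qed

text \<open>Differentiating a polynomial at 0 keeps only its linear coefficient; both first
  variations below are computed in this way.\<close>

lemma DERIV_power_at_0:
  "((\<lambda>s :: real. s ^ n) has_real_derivative (if n = 1 then 1 else 0)) (at 0)"
proof -
  have "((\<lambda>s :: real. s ^ n) has_real_derivative real n * 0 ^ (n - Suc 0)) (at 0)"
    by (rule DERIV_pow)
  also have "real n * 0 ^ (n - Suc 0) = (if n = 1 then 1 else 0)"
    by (cases n) auto
  finally show ?thesis .
qed

section \<open>Cube forms and the independence of antipodal points\<close>

context compact_haar
begin

text \<open>Functions rather than classes, since their values at shifted points must be measurable.
  A natural exponent permits algebraic expansions, and the absolute value matters for the odd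
  exponent \<open>2 ^ 0 = 1\<close>.\<close>

definition baire_Lp :: "nat \<Rightarrow> ('a \<Rightarrow> real) set" where
  "baire_Lp n = {f \<in> borel_measurable baire. integrable M (\<lambda>x. \<bar>f x\<bar> ^ n)}"

definition cube_space :: "nat \<Rightarrow> ('a \<times> (nat \<Rightarrow> 'a)) measure" where
  "cube_space d = M \<Otimes>\<^sub>M (\<Pi>\<^sub>M i\<in>{..<d}. M)"

definition cube_prod :: "nat \<Rightarrow> ((nat \<Rightarrow> nat) \<Rightarrow> 'a \<Rightarrow> real) \<Rightarrow> 'a \<times> (nat \<Rightarrow> 'a) \<Rightarrow> real" where
  "cube_prod d F z = (\<Prod>\<epsilon>\<in>cube d. F \<epsilon> (fst z + cube_dot d \<epsilon> (snd z)))"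

text \<open>The multilinear Gowers form, with one function per vertex. On a constant family of Baire
  functions it is the \<open>2^d\<close>-th power of the Gowers norm.\<close>

definition cube_form :: "nat \<Rightarrow> ((nat \<Rightarrow> nat) \<Rightarrow> 'a \<Rightarrow> real) \<Rightarrow> real" where
  "cube_form d F = (\<integral>z. cube_prod d F z \<partial>cube_space d)"

text \<open>This does not depend on \<open>t i\<close>.\<close>

definition half :: "nat \<Rightarrow> nat \<Rightarrow> ((nat \<Rightarrow> nat) \<Rightarrow> 'a \<Rightarrow> real) \<Rightarrow> 'a \<Rightarrow> (nat \<Rightarrow> 'a) \<Rightarrow> real" where
  "half d i F x t = (\<Prod>\<epsilon>\<in>{\<epsilon>\<in>cube d. \<epsilon> i = 0}. F \<epsilon> (x + cube_dot d \<epsilon> t))"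

lemma prob_PiM: "prob_space (\<Pi>\<^sub>M i\<in>I. M)"
  by (intro prob_space_PiM prob_space_axioms)

lemma sigma_finite_PiM: "sigma_finite_measure (\<Pi>\<^sub>M i\<in>I. M)"
  by (intro prob_space_imp_sigma_finite prob_PiM)

lemma baire_cube_dot:
  assumes "\<And>i. i < d \<Longrightarrow> \<epsilon> i = 1 \<Longrightarrow> (\<lambda>z. T z i) \<in> N \<rightarrow>\<^sub>M M"
  shows "(\<lambda>z. cube_dot d \<epsilon> (T z)) \<in> N \<rightarrow>\<^sub>M baire"
proof -
  have "(\<lambda>z. \<Sum>i\<in>A. if \<epsilon> i = 1 then T z i else 0) \<in> N \<rightarrow>\<^sub>M baire"
    if "finite A" "A \<subseteq> {..<d}" for A
    using that
  proof induction
    case (insert i A)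
    then have "(\<lambda>z. if \<epsilon> i = 1 then T z i else 0) \<in> N \<rightarrow>\<^sub>M baire"
      using assms[of i] by (cases "\<epsilon> i = 1") (auto intro: measurable_M_baire)
    then show ?case
      using insert by (simp add: baire_add)
  qed auto
  then show ?thesis
    unfolding cube_dot_def by simp
qed

lemma cube_factor_measurable:
  assumes "f \<in> baire \<rightarrow>\<^sub>M K" "X \<in> N \<rightarrow>\<^sub>M baire" "\<And>i. i < d \<Longrightarrow> \<epsilon> i = 1 \<Longrightarrow> (\<lambda>z. T z i) \<in> N \<rightarrow>\<^sub>M M"
  shows "(\<lambda>z. f (X z + cube_dot d \<epsilon> (T z))) \<in> N \<rightarrow>\<^sub>M K"
  by (rule measurable_compose[OF baire_add[OF assms(2) baire_cube_dot[OF assms(3)]] assms(1)])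

lemma cube_factor_measurable_pair:
  assumes "f \<in> baire \<rightarrow>\<^sub>M K"
  shows "(\<lambda>z. f (fst z + cube_dot d \<epsilon> (snd z))) \<in> cube_space d \<rightarrow>\<^sub>M K"
  unfolding cube_space_def using assms
  by (rule cube_factor_measurable) (auto intro!: measurable_M_baire)

lemma measurable_resample:
  assumes i: "i < d"
  shows "(\<lambda>((t, x), s). (x, t(i := s))) \<in>
    ((\<Pi>\<^sub>M j\<in>{..<d} - {i}. M) \<Otimes>\<^sub>M M) \<Otimes>\<^sub>M M \<rightarrow>\<^sub>M cube_space d"
proof -
  let ?P = "\<Pi>\<^sub>M j\<in>{..<d} - {i}. M"
  have ins: "insert i ({..<d} - {i}) = {..<d}"
    using i by auto
  have upd: "(\<lambda>z. (fst z)(i := snd z)) \<in> ?P \<Otimes>\<^sub>M M \<rightarrow>\<^sub>M (\<Pi>\<^sub>M j\<in>{..<d}. M)"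
    using measurable_add_dim[of i "{..<d} - {i}" "\<lambda>_. M"] by (simp add: ins split_beta' del: insert_Diff_single)
  show ?thesis
    unfolding cube_space_def split_beta'
    by (intro measurable_Pair measurable_compose[OF _ upd, of "\<lambda>z. (fst (fst z), snd z)", simplified]) auto
qed

text \<open>By Fubini, a point of \<open>Z \<times> Z^d\<close> may be drawn with its coordinate
  \<open>t i\<close> last. In this order \<open>s\<close> is integrated first and \<open>x\<close>
  second, with the remaining coordinates fixed, as translation invariance requires.\<close>

lemma distr_resample:
  assumes i: "i < d"
  shows "distr (((\<Pi>\<^sub>M j\<in>{..<d} - {i}. M) \<Otimes>\<^sub>M M) \<Otimes>\<^sub>M M) (cube_space d) (\<lambda>((t, x), s). (x, t(i := s))) = cube_space d"
    (is "distr ?T _ ?h = _")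
proof (rule measure_eqI)
  let ?P = "\<Pi>\<^sub>M j\<in>{..<d} - {i}. M"
  interpret P: sigma_finite_measure ?P by (rule sigma_finite_PiM)
  interpret Q: sigma_finite_measure "\<Pi>\<^sub>M j\<in>{..<d}. M" by (rule sigma_finite_PiM)
  interpret PMp: pair_sigma_finite ?P M ..
  have ins: "insert i ({..<d} - {i}) = {..<d}"
    using i by auto
  note h = measurable_resample[OF i]
  fix X assume "X \<in> sets (distr ?T (cube_space d) ?h)"
  then have X: "X \<in> sets (cube_space d)"
    by simp
  have [measurable]: "indicator X \<in> borel_measurable (M \<Otimes>\<^sub>M (\<Pi>\<^sub>M j\<in>{..<d}. M))"
    using X by (simp add: cube_space_def)
  have meas: "(\<lambda>w. indicator X (?h w)) \<in> borel_measurable ?T"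
    using X by (intro measurable_compose[OF h]) auto
  have "emeasure (distr ?T (cube_space d) ?h) X = (\<integral>\<^sup>+w. indicator X (?h w) \<partial>?T)"
    using X nn_integral_distr[OF h, of "indicator X"] by simp
  also have "\<dots> = (\<integral>\<^sup>+z. \<integral>\<^sup>+s. indicator X (?h (z, s)) \<partial>M \<partial>(?P \<Otimes>\<^sub>M M))"
    using meas by (rule nn_integral_fst[symmetric])
  \<comment> \<open>Moving \<open>x\<close> to the outside makes \<open>t\<close> and
    \<open>s\<close> adjacent, so that they merge into the full product.\<close>
  also have "\<dots> = (\<integral>\<^sup>+x. \<integral>\<^sup>+t. \<integral>\<^sup>+s. indicator X (?h ((t, x), s)) \<partial>M \<partial>?P \<partial>M)"
    by (rule PMp.nn_integral_snd[symmetric]) (rule borel_measurable_nn_integral_fst[OF meas])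
  also have "\<dots> = (\<integral>\<^sup>+x. \<integral>\<^sup>+t. indicator X (x, t) \<partial>(\<Pi>\<^sub>M j\<in>{..<d}. M) \<partial>M)"
  proof (rule nn_integral_cong)
    fix x
    have "(\<lambda>t. indicator X (x, t)) \<in> borel_measurable (\<Pi>\<^sub>M j\<in>{..<d}. M)"
      by measurable
    then show "(\<integral>\<^sup>+t. \<integral>\<^sup>+s. indicator X (?h ((t, x), s)) \<partial>M \<partial>?P) = (\<integral>\<^sup>+t. indicator X (x, t) \<partial>(\<Pi>\<^sub>M j\<in>{..<d}. M))"
      using PM.product_nn_integral_insert[of "{..<d} - {i}" i "\<lambda>t. indicator X (x, t)"]
      by (simp add: ins del: insert_Diff_single)
  qed
  also have "\<dots> = (\<integral>\<^sup>+z. indicator X z \<partial>cube_space d)"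
    unfolding cube_space_def by (rule sigma_finite_measure.nn_integral_fst[OF sigma_finite_PiM]) measurable
  also have "\<dots> = emeasure (cube_space d) X"
    using X by simp
  finally show "emeasure (distr ?T (cube_space d) ?h) X = emeasure (cube_space d) X" .
qed simp

text \<open>The coordinate \<open>t 0\<close> shifts just one of the two arguments. Integrating over
  it decouples that factor by invariance, and integrating over the base point then evaluates the
  other one.\<close>

lemma nn_integral_antipodal:
  fixes u v :: "'a \<Rightarrow> ennreal"
  assumes u: "u \<in> borel_measurable baire" and v: "v \<in> borel_measurable baire"
    and \<epsilon>: "\<epsilon> \<in> cube d" and d: "d \<ge> 1"
  shows "(\<integral>\<^sup>+z. u (fst z + cube_dot d \<epsilon> (snd z)) * v (fst z + cube_dot d (antipode d \<epsilon>) (snd z)) \<partial>cube_space d)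
    = (\<integral>\<^sup>+x. u x \<partial>M) * (\<integral>\<^sup>+x. v x \<partial>M)"
proof -
  \<comment> \<open>Only coordinate 0 distinguishes the vertices in this argument. The opposite
    orientation is obtained at the end by exchanging \<open>u\<close> and \<open>v\<close>.\<close>
  have *: "(\<integral>\<^sup>+z. u (fst z + cube_dot d \<epsilon> (snd z)) * v (fst z + cube_dot d \<eta> (snd z)) \<partial>cube_space d)
    = (\<integral>\<^sup>+x. u x \<partial>M) * (\<integral>\<^sup>+x. v x \<partial>M)"
    if u: "u \<in> borel_measurable baire" and v: "v \<in> borel_measurable baire" and "\<epsilon> 0 = 0" "\<eta> 0 = 1"
    for u v :: "'a \<Rightarrow> ennreal" and \<epsilon> \<eta>
  proof -
    let ?P = "\<Pi>\<^sub>M j\<in>{..<d} - {0}. M"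
    let ?T = "(?P \<Otimes>\<^sub>M M) \<Otimes>\<^sub>M M"
    let ?h = "\<lambda>((t, x), s). (x :: 'a, t(0 := s))"
    interpret P: prob_space ?P by (rule prob_PiM)
    interpret PMp: pair_sigma_finite ?P M ..
    note uM = baire_measurable_M[OF u] and vM = baire_measurable_M[OF v]
    define \<zeta> where "\<zeta> = \<eta>(0 := 0)"
    have \<zeta>: "\<eta> = \<zeta>(0 := 1)" "\<zeta> 0 \<noteq> 1"
      using that by (auto simp: \<zeta>_def)
    have dot: "cube_dot d \<epsilon> (t(0 := s)) = cube_dot d \<epsilon> t" "cube_dot d \<eta> (t(0 := s)) = cube_dot d \<zeta> t + s"
      for t and s :: 'a
      using that(3) d \<zeta>(2) cube_dot_upd_1[of 0 d \<zeta> t s] unfolding \<zeta>(1) by (auto simp: cube_dot_upd_0)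
    have fm: "(\<lambda>w. u (snd w + cube_dot d \<epsilon> (fst w))) \<in> borel_measurable (?P \<Otimes>\<^sub>M M)"
    proof (rule cube_factor_measurable[OF u])
      show "(\<lambda>w. fst w i) \<in> ?P \<Otimes>\<^sub>M M \<rightarrow>\<^sub>M M" if "i < d" "\<epsilon> i = 1" for i
      proof (rule measurable_compose[OF measurable_fst measurable_component_singleton])
        have "i \<noteq> 0"
          using that(2) \<open>\<epsilon> 0 = 0\<close> by (metis zero_neq_one)
        then show "i \<in> {..<d} - {0}"
          using that(1) by simp
      qed
    qed (auto intro!: measurable_M_baire)
    have hm: "?h \<in> ?T \<rightarrow>\<^sub>M cube_space d"
      using d by (intro measurable_resample) simp
    let ?G = "\<lambda>z. u (fst z + cube_dot d \<epsilon> (snd z)) * v (fst z + cube_dot d \<eta> (snd z))"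
    have G: "?G \<in> borel_measurable (cube_space d)"
      by (intro borel_measurable_times_ennreal cube_factor_measurable_pair u v)
    have "(\<integral>\<^sup>+z. ?G z \<partial>cube_space d) = (\<integral>\<^sup>+w. ?G (?h w) \<partial>?T)"
      using nn_integral_distr[OF hm, of ?G] G distr_resample[of 0 d] d by simp
    also have "\<dots> = (\<integral>\<^sup>+z. \<integral>\<^sup>+s. ?G (?h (z, s)) \<partial>M \<partial>(?P \<Otimes>\<^sub>M M))"
      by (rule nn_integral_fst[symmetric]) (rule measurable_compose[OF hm G])
    also have "\<dots> = (\<integral>\<^sup>+z. u (snd z + cube_dot d \<epsilon> (fst z)) * (\<integral>\<^sup>+x. v x \<partial>M) \<partial>(?P \<Otimes>\<^sub>M M))"
    proof (rule nn_integral_cong)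
      fix z :: "(nat \<Rightarrow> 'a) \<times> 'a"
      have "(\<lambda>s. v ((snd z + cube_dot d \<zeta> (fst z)) + s)) \<in> borel_measurable M"
        by (intro measurable_compose[OF baire_add v] measurable_ident_baire measurable_const) auto
      then show "(\<integral>\<^sup>+s. ?G (?h (z, s)) \<partial>M) = u (snd z + cube_dot d \<epsilon> (fst z)) * (\<integral>\<^sup>+x. v x \<partial>M)"
        using nn_integral_translate[OF vM, of "snd z + cube_dot d \<zeta> (fst z)"]
        by (simp add: split_beta' dot nn_integral_cmult add.assoc)
    qed
    also have "\<dots> = (\<integral>\<^sup>+z. u (snd z + cube_dot d \<epsilon> (fst z)) \<partial>(?P \<Otimes>\<^sub>M M)) * (\<integral>\<^sup>+x. v x \<partial>M)"
      by (rule nn_integral_multc[OF fm])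
    also have "(\<integral>\<^sup>+z. u (snd z + cube_dot d \<epsilon> (fst z)) \<partial>(?P \<Otimes>\<^sub>M M))
        = (\<integral>\<^sup>+t. \<integral>\<^sup>+x. u (x + cube_dot d \<epsilon> t) \<partial>M \<partial>?P)"
      using nn_integral_fst[OF fm] by simp
    also have "\<dots> = (\<integral>\<^sup>+x. u x \<partial>M)"
    proof -
      have "(\<integral>\<^sup>+x. u (x + c) \<partial>M) = (\<integral>\<^sup>+x. u x \<partial>M)" for c
        using nn_integral_translate[OF uM, of c] by (simp add: add.commute[of c])
      then show ?thesis
        by (simp add: prob_space.emeasure_space_1[OF prob_PiM])
    qed
    finally show ?thesis .
  qed
  have a: "antipode d \<epsilon> 0 = 1 - \<epsilon> 0"
    using d by (simp add: antipode_def)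
  from cube_values[OF \<epsilon>, of 0] d consider "\<epsilon> 0 = 0" | "\<epsilon> 0 = 1" by auto
  then show ?thesis
  proof cases
    case 1
    then show ?thesis using *[OF u v] a by simp
  next
    case 2
    then show ?thesis using *[OF v u, of "antipode d \<epsilon>" \<epsilon>] a by (simp add: mult.commute)
  qed
qed

lemma integral_antipodal:
  fixes u v :: "'a \<Rightarrow> real"
  assumes u: "u \<in> borel_measurable baire" "integrable M u" "\<And>x. u x \<ge> 0"
    and v: "v \<in> borel_measurable baire" "integrable M v" "\<And>x. v x \<ge> 0"
    and \<epsilon>: "\<epsilon> \<in> cube d" and d: "d \<ge> 1"
  shows "integrable (cube_space d) (\<lambda>z. u (fst z + cube_dot d \<epsilon> (snd z)) * v (fst z + cube_dot d (antipode d \<epsilon>) (snd z)))"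
      (is "integrable _ ?G")
    and "(\<integral>z. u (fst z + cube_dot d \<epsilon> (snd z)) * v (fst z + cube_dot d (antipode d \<epsilon>) (snd z)) \<partial>cube_space d)
      = (\<integral>x. u x \<partial>M) * (\<integral>x. v x \<partial>M)"
proof -
  have G: "?G \<in> borel_measurable (cube_space d)"
    by (intro borel_measurable_times cube_factor_measurable_pair u v)
  have "(\<integral>\<^sup>+z. ennreal (?G z) \<partial>cube_space d) = (\<integral>\<^sup>+x. ennreal (u x) \<partial>M) * (\<integral>\<^sup>+x. ennreal (v x) \<partial>M)"
    using nn_integral_antipodal[of "\<lambda>x. ennreal (u x)" "\<lambda>x. ennreal (v x)", OF _ _ \<epsilon> d] u v
    by (simp add: ennreal_mult)
  also have "\<dots> = ennreal ((\<integral>x. u x \<partial>M) * (\<integral>x. v x \<partial>M))"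
    using u v by (simp add: nn_integral_eq_integral ennreal_mult)
  finally have "integrable (cube_space d) ?G \<and> (\<integral>z. ?G z \<partial>cube_space d) = (\<integral>x. u x \<partial>M) * (\<integral>x. v x \<partial>M)"
    using G u v by (subst (asm) nn_integral_eq_integrable) auto
  then show "integrable (cube_space d) ?G"
    and "(\<integral>z. ?G z \<partial>cube_space d) = (\<integral>x. u x \<partial>M) * (\<integral>x. v x \<partial>M)"
    by auto
qed

section \<open>Convergence of cube forms and factorisation along one coordinate\<close>

lemma cube_prod_measurable:
  assumes "\<And>\<epsilon>. \<epsilon> \<in> cube d \<Longrightarrow> F \<epsilon> \<in> borel_measurable baire"
  shows "cube_prod d F \<in> borel_measurable (cube_space d)"
  unfolding cube_prod_def[abs_def]
  by (intro borel_measurable_prod cube_factor_measurable_pair assms)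

text \<open>The product over the cube is dominated by antipodal pairs raised to the power
  \<open>2^(d-1)\<close>. Independence of the two points then makes the \<open>2^(d-1)\<close>-th
  moments sufficient.\<close>

lemma
  assumes d: "d \<ge> 1" and F: "\<And>\<epsilon>. \<epsilon> \<in> cube d \<Longrightarrow> F \<epsilon> \<in> baire_Lp (2 ^ (d - 1))"
  shows integrable_cube_prod: "integrable (cube_space d) (cube_prod d F)"
    and abs_cube_form_le: "\<bar>cube_form d F\<bar> \<le> (\<Sum>\<epsilon>\<in>cube d.
      (\<integral>x. \<bar>F \<epsilon> x\<bar> ^ 2 ^ (d - 1) \<partial>M) * (\<integral>x. \<bar>F (antipode d \<epsilon>) x\<bar> ^ 2 ^ (d - 1) \<partial>M))"
proof -
  let ?m = "2 ^ (d - 1) :: nat"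
  let ?G = "\<lambda>\<epsilon> z. \<bar>F \<epsilon> (fst z + cube_dot d \<epsilon> (snd z))\<bar> ^ ?m *
    \<bar>F (antipode d \<epsilon>) (fst z + cube_dot d (antipode d \<epsilon>) (snd z))\<bar> ^ ?m"
  have bm: "F \<epsilon> \<in> borel_measurable baire" "integrable M (\<lambda>x. \<bar>F \<epsilon> x\<bar> ^ ?m)" if "\<epsilon> \<in> cube d" for \<epsilon>
    using F[OF that] by (auto simp: baire_Lp_def)
  have G: "integrable (cube_space d) (?G \<epsilon>)"
      "(\<integral>z. ?G \<epsilon> z \<partial>cube_space d) = (\<integral>x. \<bar>F \<epsilon> x\<bar> ^ ?m \<partial>M) * (\<integral>x. \<bar>F (antipode d \<epsilon>) x\<bar> ^ ?m \<partial>M)"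
    if \<epsilon>: "\<epsilon> \<in> cube d" for \<epsilon>
    using bm[OF \<epsilon>] bm[OF antipode_cube[OF \<epsilon>]]
      integral_antipodal[of "\<lambda>x. \<bar>F \<epsilon> x\<bar> ^ ?m" "\<lambda>x. \<bar>F (antipode d \<epsilon>) x\<bar> ^ ?m", OF _ _ _ _ _ _ \<epsilon> d]
    by auto
  have Gs: "integrable (cube_space d) (\<lambda>z. \<Sum>\<epsilon>\<in>cube d. ?G \<epsilon> z)"
    using G by auto
  have le: "\<bar>cube_prod d F z\<bar> \<le> (\<Sum>\<epsilon>\<in>cube d. ?G \<epsilon> z)" for z
    using prod_cube_le_sum_antipodal[OF d, of "\<lambda>\<epsilon>. \<bar>F \<epsilon> (fst z + cube_dot d \<epsilon> (snd z))\<bar>"]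
    unfolding cube_prod_def by (simp add: abs_prod power_mult_distrib)
  show int: "integrable (cube_space d) (cube_prod d F)"
  proof (rule Bochner_Integration.integrable_bound[OF Gs])
    show "AE z in cube_space d. norm (cube_prod d F z) \<le> norm (\<Sum>\<epsilon>\<in>cube d. ?G \<epsilon> z)"
      using le by (auto intro!: AE_I2 intro: order.trans[OF _ abs_ge_self])
  qed (intro cube_prod_measurable bm)
  have "\<bar>cube_form d F\<bar> \<le> (\<integral>z. \<bar>cube_prod d F z\<bar> \<partial>cube_space d)"
    unfolding cube_form_def by (rule integral_abs_bound)
  also have "\<dots> \<le> (\<integral>z. (\<Sum>\<epsilon>\<in>cube d. ?G \<epsilon> z) \<partial>cube_space d)"
    using Gs int le by (intro integral_mono) auto
  also have "\<dots> = (\<Sum>\<epsilon>\<in>cube d. (\<integral>z. ?G \<epsilon> z \<partial>cube_space d))"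
    using G by (intro Bochner_Integration.integral_sum) auto
  also have "\<dots> = (\<Sum>\<epsilon>\<in>cube d.
      (\<integral>x. \<bar>F \<epsilon> x\<bar> ^ 2 ^ (d - 1) \<partial>M) * (\<integral>x. \<bar>F (antipode d \<epsilon>) x\<bar> ^ 2 ^ (d - 1) \<partial>M))"
    using G by (intro sum.cong) auto
  finally show "\<bar>cube_form d F\<bar> \<le> (\<Sum>\<epsilon>\<in>cube d.
      (\<integral>x. \<bar>F \<epsilon> x\<bar> ^ 2 ^ (d - 1) \<partial>M) * (\<integral>x. \<bar>F (antipode d \<epsilon>) x\<bar> ^ 2 ^ (d - 1) \<partial>M))" .
qed

text \<open>The face where coordinate \<open>i\<close> is 0 does not see \<open>s\<close>; on the
  opposite face \<open>s\<close> acts as a translation of the base point.\<close>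

lemma cube_prod_split:
  assumes i: "i < d"
  shows "cube_prod d F (x, t(i := s)) = half d i F x t * half d i (\<lambda>\<epsilon>. F (\<epsilon>(i := 1))) (x + s) t"
proof -
  let ?f = "\<lambda>\<epsilon>. F \<epsilon> (x + cube_dot d \<epsilon> (t(i := s)))"
  have "cube_prod d F (x, t(i := s)) = prod ?f {\<epsilon>\<in>cube d. \<epsilon> i = 0} * prod ?f {\<epsilon>\<in>cube d. \<epsilon> i = 1}"
    unfolding cube_prod_def using cube_values[OF _ i]
    by (subst prod.union_disjoint[symmetric]) (auto intro!: prod.cong)
  also have "prod ?f {\<epsilon>\<in>cube d. \<epsilon> i = 0} = half d i F x t"
    unfolding half_def by (intro prod.cong) (auto simp: cube_dot_upd_0)
  also have "prod ?f {\<epsilon>\<in>cube d. \<epsilon> i = 1} = (\<Prod>\<epsilon>\<in>{\<epsilon>\<in>cube d. \<epsilon> i = 0}. ?f (\<epsilon>(i := 1)))"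
    by (rule prod.reindex_bij_witness[of _ "\<lambda>\<epsilon>. \<epsilon>(i := 1)" "\<lambda>\<epsilon>. \<epsilon>(i := 0)"])
      (use i in \<open>auto simp: cube_update fun_upd_idem\<close>)
  also have "\<dots> = half d i (\<lambda>\<epsilon>. F (\<epsilon>(i := 1))) (x + s) t"
    unfolding half_def
  proof (intro prod.cong refl)
    fix \<epsilon> assume "\<epsilon> \<in> {\<epsilon>\<in>cube d. \<epsilon> i = 0}"
    then have "cube_dot d (\<epsilon>(i := 1)) (t(i := s)) = cube_dot d \<epsilon> t + s"
      using i by (intro cube_dot_upd_1) auto
    then show "?f (\<epsilon>(i := 1)) = F (\<epsilon>(i := 1)) (x + s + cube_dot d \<epsilon> t)"
      by (simp only: algebra_simps)
  qed
  finally show ?thesis .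
qed

text \<open>For fixed remaining coordinates the two opposite faces are integrated over independent
  base points \<open>x\<close> and \<open>x + s\<close>. The form becomes an integral of products,
  ready for an inequality of Cauchy-Schwarz type.\<close>

lemma
  assumes F: "\<And>\<epsilon>. \<epsilon> \<in> cube d \<Longrightarrow> F \<epsilon> \<in> borel_measurable baire"
    and int: "integrable (cube_space d) (cube_prod d F)" and i: "i < d"
  shows integrable_half_product: "integrable (\<Pi>\<^sub>M j\<in>{..<d} - {i}. M)
      (\<lambda>t. (\<integral>x. half d i F x t \<partial>M) * (\<integral>x. half d i (\<lambda>\<epsilon>. F (\<epsilon>(i := 1))) x t \<partial>M))"
    and cube_form_eq_half: "cube_form d F =
      (\<integral>t. (\<integral>x. half d i F x t \<partial>M) * (\<integral>x. half d i (\<lambda>\<epsilon>. F (\<epsilon>(i := 1))) x t \<partial>M) \<partial>(\<Pi>\<^sub>M j\<in>{..<d} - {i}. M))"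
proof -
  let ?P = "\<Pi>\<^sub>M j\<in>{..<d} - {i}. M"
  let ?T = "(?P \<Otimes>\<^sub>M M) \<Otimes>\<^sub>M M"
  let ?h = "\<lambda>((t, x), s). (x :: 'a, t(i := s))"
  let ?F1 = "\<lambda>\<epsilon>. F (\<epsilon>(i := 1))"
  interpret P: prob_space ?P by (rule prob_PiM)
  interpret PM': pair_prob_space ?P M ..
  interpret T: pair_prob_space "?P \<Otimes>\<^sub>M M" M ..
  have hm: "?h \<in> ?T \<rightarrow>\<^sub>M cube_space d"
    by (rule measurable_resample[OF i])
  have G: "cube_prod d F \<in> borel_measurable (cube_space d)"
    by (rule cube_prod_measurable[OF F])
  have intT: "integrable ?T (\<lambda>w. cube_prod d F (?h w))"
    using int integrable_distr_eq[OF hm G] distr_resample[OF i] by simp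
  \<comment> \<open>By invariance the integral over \<open>s\<close> is independent of the base
    point \<open>snd z\<close>, so it is a constant for the next integration.\<close>
  have inner: "(\<integral>s. cube_prod d F (?h (z, s)) \<partial>M) = half d i F (snd z) (fst z) * (\<integral>x. half d i ?F1 x (fst z) \<partial>M)"
    for z
  proof -
    have "(\<lambda>x. half d i ?F1 x (fst z)) \<in> borel_measurable M"
      unfolding half_def
      by (intro borel_measurable_prod measurable_compose[OF baire_add F] measurable_ident_baire measurable_const)
        (use i in \<open>auto simp: cube_update\<close>)
    then have "(\<integral>s. half d i ?F1 (snd z + s) (fst z) \<partial>M) = (\<integral>x. half d i ?F1 x (fst z) \<partial>M)"
      by (rule integral_translate)
    then show ?thesis
      by (simp add: split_beta' cube_prod_split[OF i])
  qed
  have int2: "integrable (?P \<Otimes>\<^sub>M M) (\<lambda>z. half d i F (snd z) (fst z) * (\<integral>x. half d i ?F1 x (fst z) \<partial>M))"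
    using T.integrable_fst'[OF intT] unfolding inner .
  show "integrable ?P (\<lambda>t. (\<integral>x. half d i F x t \<partial>M) * (\<integral>x. half d i ?F1 x t \<partial>M))"
    using PM'.integrable_fst'[OF int2] by simp
  have "cube_form d F = (\<integral>w. cube_prod d F (?h w) \<partial>?T)"
    unfolding cube_form_def using integral_distr[OF hm G] distr_resample[OF i] by simp
  also have "\<dots> = (\<integral>z. half d i F (snd z) (fst z) * (\<integral>x. half d i ?F1 x (fst z) \<partial>M) \<partial>(?P \<Otimes>\<^sub>M M))"
    using T.integral_fst'[OF intT] unfolding inner by simp
  also have "\<dots> = (\<integral>t. (\<integral>x. half d i F x t \<partial>M) * (\<integral>x. half d i ?F1 x t \<partial>M) \<partial>?P)"
    using PM'.integral_fst'[OF int2] by simp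
  finally show "cube_form d F = (\<integral>t. (\<integral>x. half d i F x t \<partial>M) * (\<integral>x. half d i ?F1 x t \<partial>M) \<partial>?P)" .
qed

section \<open>The Gowers-Cauchy-Schwarz inequality and convexity\<close>

lemma baire_LpD:
  assumes "f \<in> baire_Lp n"
  shows "f \<in> borel_measurable baire" "f \<in> borel_measurable M" "integrable M (\<lambda>x. \<bar>f x\<bar> ^ n)"
  using assms baire_measurable_M by (auto simp: baire_Lp_def)

lemma baire_LpI_le:
  assumes f: "f \<in> borel_measurable baire" and u: "integrable M u" and le: "\<And>x. \<bar>f x\<bar> ^ n \<le> u x"
  shows "f \<in> baire_Lp n"
  unfolding baire_Lp_def
proof (intro CollectI conjI f Bochner_Integration.integrable_bound[OF u])
  show "(\<lambda>x. \<bar>f x\<bar> ^ n) \<in> borel_measurable M"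
    using baire_measurable_M[OF f] by auto
  show "AE x in M. norm (\<bar>f x\<bar> ^ n) \<le> norm (u x)"
    using le by (auto intro!: AE_I2 intro: order.trans[OF _ abs_ge_self])
qed

lemma baire_Lp_mono:
  assumes "n \<le> m"
  shows "baire_Lp m \<subseteq> baire_Lp n"
proof
  fix f assume f: "f \<in> baire_Lp m"
  then have "integrable M (\<lambda>x. 1 + \<bar>f x\<bar> ^ m)"
    using baire_LpD[OF f] by auto
  then show "f \<in> baire_Lp n"
    using baire_LpD[OF f] power_le_1_plus_power[OF abs_ge_zero assms]
    by (intro baire_LpI_le)
qed

lemma baire_Lp_add:
  assumes f: "f \<in> baire_Lp n" and g: "g \<in> baire_Lp n"
  shows "(\<lambda>x. f x + g x) \<in> baire_Lp n"
proof (rule baire_LpI_le)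
  show "(\<lambda>x. f x + g x) \<in> borel_measurable baire"
    using baire_LpD[OF f] baire_LpD[OF g] by auto
  show "integrable M (\<lambda>x. 2 ^ n * (\<bar>f x\<bar> ^ n + \<bar>g x\<bar> ^ n))"
    using baire_LpD[OF f] baire_LpD[OF g] by auto
  fix x
  have "\<bar>f x + g x\<bar> ^ n \<le> (2 * max \<bar>f x\<bar> \<bar>g x\<bar>) ^ n"
    by (intro power_mono) auto
  also have "\<dots> = 2 ^ n * max \<bar>f x\<bar> \<bar>g x\<bar> ^ n"
    by (simp add: power_mult_distrib)
  also have "\<dots> \<le> 2 ^ n * (\<bar>f x\<bar> ^ n + \<bar>g x\<bar> ^ n)"
    by (intro mult_left_mono) (auto simp: max_def)
  finally show "\<bar>f x + g x\<bar> ^ n \<le> 2 ^ n * (\<bar>f x\<bar> ^ n + \<bar>g x\<bar> ^ n)" .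
qed

lemma baire_Lp_scale:
  assumes f: "f \<in> baire_Lp n"
  shows "(\<lambda>x. c * f x) \<in> baire_Lp n"
  using baire_LpD[OF f] by (auto simp: baire_Lp_def abs_mult power_mult_distrib)

lemma baire_Lp_diff:
  assumes f: "f \<in> baire_Lp n" and g: "g \<in> baire_Lp n"
  shows "(\<lambda>x. f x - g x) \<in> baire_Lp n"
  using baire_Lp_add[OF f baire_Lp_scale[OF g, of "-1"]] by simp

lemma baire_Lp_bounded:
  assumes "f \<in> borel_measurable baire" "\<And>x. \<bar>f x\<bar> \<le> C"
  shows "f \<in> baire_Lp n"
  using assms by (intro baire_LpI_le[of _ "\<lambda>_. C ^ n"]) (auto intro: power_mono)

section \<open>Multilinearity, averaging and convexity of the cube form\<close>

lemma cube_form_cong: "(\<And>\<epsilon>. \<epsilon> \<in> cube d \<Longrightarrow> F \<epsilon> = G \<epsilon>) \<Longrightarrow> cube_form d F = cube_form d G"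
  unfolding cube_form_def cube_prod_def by simp

lemma half_cong: "(\<And>\<epsilon>. \<epsilon> \<in> cube d \<Longrightarrow> \<epsilon> i = 0 \<Longrightarrow> F \<epsilon> = G \<epsilon>) \<Longrightarrow> half d i F x t = half d i G x t"
  unfolding half_def by simp

lemma cube_form_scale: "cube_form d (\<lambda>\<epsilon> x. c \<epsilon> * F \<epsilon> x) = (\<Prod>\<epsilon>\<in>cube d. c \<epsilon>) * cube_form d F"
  unfolding cube_form_def cube_prod_def by (simp add: prod.distrib)

lemma cube_form_add:
  assumes d: "d \<ge> 1"
    and A: "\<And>\<epsilon>. \<epsilon> \<in> cube d \<Longrightarrow> A \<epsilon> \<in> baire_Lp (2 ^ (d - 1))"
    and B: "\<And>\<epsilon>. \<epsilon> \<in> cube d \<Longrightarrow> B \<epsilon> \<in> baire_Lp (2 ^ (d - 1))"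
  shows "cube_form d (\<lambda>\<epsilon> x. A \<epsilon> x + B \<epsilon> x)
    = (\<Sum>X\<in>Pow (cube d). cube_form d (\<lambda>\<epsilon>. if \<epsilon> \<in> X then A \<epsilon> else B \<epsilon>))"
proof -
  have "cube_prod d (\<lambda>\<epsilon> x. A \<epsilon> x + B \<epsilon> x) z = (\<Sum>X\<in>Pow (cube d). cube_prod d (\<lambda>\<epsilon>. if \<epsilon> \<in> X then A \<epsilon> else B \<epsilon>) z)" for z
    unfolding cube_prod_def prod_add[OF finite_cube]
  proof (intro sum.cong refl)
    fix X assume X: "X \<in> Pow (cube d)"
    let ?y = "\<lambda>\<epsilon>. fst z + cube_dot d \<epsilon> (snd z)"
    have "(\<Prod>\<epsilon>\<in>cube d. (if \<epsilon> \<in> X then A \<epsilon> else B \<epsilon>) (?y \<epsilon>)) =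
        (\<Prod>\<epsilon>\<in>cube d - X. (if \<epsilon> \<in> X then A \<epsilon> else B \<epsilon>) (?y \<epsilon>)) * (\<Prod>\<epsilon>\<in>X. (if \<epsilon> \<in> X then A \<epsilon> else B \<epsilon>) (?y \<epsilon>))"
      using X by (intro prod.subset_diff) auto
    then show "(\<Prod>\<epsilon>\<in>X. A \<epsilon> (?y \<epsilon>)) * (\<Prod>\<epsilon>\<in>cube d - X. B \<epsilon> (?y \<epsilon>)) =
        (\<Prod>\<epsilon>\<in>cube d. (if \<epsilon> \<in> X then A \<epsilon> else B \<epsilon>) (?y \<epsilon>))"
      by (simp add: mult.commute)
  qed
  then have "cube_prod d (\<lambda>\<epsilon> x. A \<epsilon> x + B \<epsilon> x) = (\<lambda>z. \<Sum>X\<in>Pow (cube d). cube_prod d (\<lambda>\<epsilon>. if \<epsilon> \<in> X then A \<epsilon> else B \<epsilon>) z)"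
    by (rule ext)
  moreover have "integrable (cube_space d) (cube_prod d (\<lambda>\<epsilon>. if \<epsilon> \<in> X then A \<epsilon> else B \<epsilon>))" for X
    using A B by (intro integrable_cube_prod d) simp
  ultimately show ?thesis
    unfolding cube_form_def by (simp only: Bochner_Integration.integral_sum)
qed

lemma
  assumes d: "d \<ge> 1" and i: "i < d" and F: "\<And>\<epsilon>. \<epsilon> \<in> cube d \<Longrightarrow> F \<epsilon> \<in> baire_Lp (2 ^ (d - 1))"
  shows baire_Lp_integrable_half: "integrable (\<Pi>\<^sub>M j\<in>{..<d} - {i}. M)
      (\<lambda>t. (\<integral>x. half d i F x t \<partial>M) * (\<integral>x. half d i (\<lambda>\<epsilon>. F (\<epsilon>(i := 1))) x t \<partial>M))"
    and baire_Lp_cube_form_half: "cube_form d F =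
      (\<integral>t. (\<integral>x. half d i F x t \<partial>M) * (\<integral>x. half d i (\<lambda>\<epsilon>. F (\<epsilon>(i := 1))) x t \<partial>M) \<partial>(\<Pi>\<^sub>M j\<in>{..<d} - {i}. M))"
  by (rule integrable_half_product[OF baire_LpD(1)[OF F] integrable_cube_prod[OF d F] i]
      cube_form_eq_half[OF baire_LpD(1)[OF F] integrable_cube_prod[OF d F] i]; assumption)+

text \<open>One coordinate of Gowers-Cauchy-Schwarz, in the additive form
  \<open>a b \<le> (a^2 + b^2) / 2\<close> applied to the integrals over the two faces. The squares
  are the forms in which one face has been copied onto the other.\<close>

lemma cube_form_le_half_sum:
  assumes d: "d \<ge> 1" and i: "i < d" and F: "\<And>\<epsilon>. \<epsilon> \<in> cube d \<Longrightarrow> F \<epsilon> \<in> baire_Lp (2 ^ (d - 1))"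
  shows "cube_form d F \<le> (cube_form d (\<lambda>\<epsilon>. F (\<epsilon>(i := 0))) + cube_form d (\<lambda>\<epsilon>. F (\<epsilon>(i := 1)))) / 2"
proof -
  let ?P = "\<Pi>\<^sub>M j\<in>{..<d} - {i}. M"
  define a where "a t = (\<integral>x. half d i F x t \<partial>M)" for t
  define b where "b t = (\<integral>x. half d i (\<lambda>\<epsilon>. F (\<epsilon>(i := 1))) x t \<partial>M)" for t
  have F0: "F (\<epsilon>(i := 0)) \<in> baire_Lp (2 ^ (d - 1))" if "\<epsilon> \<in> cube d" for \<epsilon>
    using that i by (intro F cube_update) auto
  have F1: "F (\<epsilon>(i := 1)) \<in> baire_Lp (2 ^ (d - 1))" if "\<epsilon> \<in> cube d" for \<epsilon>
    using that i by (intro F cube_update) auto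
  have h0: "half d i (\<lambda>\<epsilon>. F (\<epsilon>(i := 0))) x t = half d i F x t" for x t
    by (intro half_cong) (simp add: fun_upd_idem)
  have "integrable ?P (\<lambda>t. a t * b t)" and ab: "cube_form d F = (\<integral>t. a t * b t \<partial>?P)"
    unfolding a_def b_def by (rule baire_Lp_integrable_half baire_Lp_cube_form_half; fact d i F)+
  moreover have "integrable ?P (\<lambda>t. a t * a t)" and aa: "cube_form d (\<lambda>\<epsilon>. F (\<epsilon>(i := 0))) = (\<integral>t. a t * a t \<partial>?P)"
    using baire_Lp_integrable_half[OF d i, of "\<lambda>\<epsilon>. F (\<epsilon>(i := 0))"]
      baire_Lp_cube_form_half[OF d i, of "\<lambda>\<epsilon>. F (\<epsilon>(i := 0))"] F0
    by (simp_all add: h0 a_def)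
  moreover have "integrable ?P (\<lambda>t. b t * b t)" and bb: "cube_form d (\<lambda>\<epsilon>. F (\<epsilon>(i := 1))) = (\<integral>t. b t * b t \<partial>?P)"
    using baire_Lp_integrable_half[OF d i, of "\<lambda>\<epsilon>. F (\<epsilon>(i := 1))"]
      baire_Lp_cube_form_half[OF d i, of "\<lambda>\<epsilon>. F (\<epsilon>(i := 1))"] F1
    by (simp_all add: b_def)
  moreover have "a t * b t \<le> (a t * a t + b t * b t) / 2" for t
    using sum_squares_ge_zero[of "a t - b t" 0] by (simp add: algebra_simps)
  ultimately have "(\<integral>t. a t * b t \<partial>?P) \<le> (\<integral>t. (a t * a t + b t * b t) / 2 \<partial>?P)"
    by (intro integral_mono) auto
  also have "\<dots> = ((\<integral>t. a t * a t \<partial>?P) + (\<integral>t. b t * b t \<partial>?P)) / 2"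
    using \<open>integrable ?P (\<lambda>t. a t * a t)\<close> \<open>integrable ?P (\<lambda>t. b t * b t)\<close> by simp
  finally show ?thesis
    by (simp only: ab aa bb)
qed

text \<open>When all entries agree, the two faces contribute equal factors and the integrand is a
  square.\<close>

lemma cube_form_const_nonneg:
  assumes d: "d \<ge> 1" and f: "f \<in> baire_Lp (2 ^ (d - 1))"
  shows "cube_form d (\<lambda>_. f) \<ge> 0"
proof -
  have "cube_form d (\<lambda>_. f) = (\<integral>t. (\<integral>x. half d 0 (\<lambda>_. f) x t \<partial>M) * (\<integral>x. half d 0 (\<lambda>_. f) x t \<partial>M) \<partial>(\<Pi>\<^sub>M j\<in>{..<d} - {0}. M))"
    using f d by (intro baire_Lp_cube_form_half) auto
  also have "\<dots> \<ge> 0"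
    by (intro integral_nonneg_AE) auto
  finally show ?thesis .
qed

text \<open>Flipping coordinate \<open>i\<close> merely exchanges the two factors of the face
  formula.\<close>

lemma cube_form_flip:
  assumes d: "d \<ge> 1" and i: "i < d" and F: "\<And>\<epsilon>. \<epsilon> \<in> cube d \<Longrightarrow> F \<epsilon> \<in> baire_Lp (2 ^ (d - 1))"
  shows "cube_form d (\<lambda>\<epsilon>. F (cube_flip i \<epsilon>)) = cube_form d F"
proof -
  have Ff: "F (cube_flip i \<epsilon>) \<in> baire_Lp (2 ^ (d - 1))" if "\<epsilon> \<in> cube d" for \<epsilon>
    using that i by (intro F cube_flip_cube)
  have h: "half d i (\<lambda>\<epsilon>. F (cube_flip i \<epsilon>)) x t = half d i (\<lambda>\<epsilon>. F (\<epsilon>(i := 1))) x t"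
      "half d i (\<lambda>\<epsilon>. F (cube_flip i (\<epsilon>(i := 1)))) x t = half d i F x t" for x t
    by (intro half_cong; simp add: cube_flip_def fun_upd_idem)+
  show ?thesis
    using baire_Lp_cube_form_half[OF d i, of F] baire_Lp_cube_form_half[OF d i, of "\<lambda>\<epsilon>. F (cube_flip i \<epsilon>)"] F Ff
    by (simp add: h mult.commute del: One_nat_def)
qed

text \<open>
  Applying the two-term bound in each coordinate. The average runs over the full cube at every
  stage \<open>j\<close>, with only the first \<open>j\<close> coordinates of \<open>\<sigma>\<close> being used.
\<close>

lemma cube_form_le_average:
  assumes d: "d \<ge> 1" and F: "\<And>\<epsilon>. \<epsilon> \<in> cube d \<Longrightarrow> F \<epsilon> \<in> baire_Lp (2 ^ (d - 1))"
  shows "cube_form d F \<le> (\<Sum>\<sigma>\<in>cube d. cube_form d (\<lambda>_. F \<sigma>)) / 2 ^ d"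
proof -
  let ?mix = "\<lambda>j \<sigma> \<epsilon> i. if i < j then \<sigma> i else \<epsilon> i"
  have mix: "?mix j \<sigma> \<epsilon> \<in> cube d" if "\<sigma> \<in> cube d" "\<epsilon> \<in> cube d" for j and \<sigma> \<epsilon> :: "nat \<Rightarrow> nat"
    using that unfolding cube_def by (auto simp: PiE_iff extensional_def)
  have "cube_form d F \<le> (\<Sum>\<sigma>\<in>cube d. cube_form d (\<lambda>\<epsilon>. F (?mix j \<sigma> \<epsilon>))) / 2 ^ d" if "j \<le> d" for j
    using that
  proof (induction j)
    case 0
    then show ?case by (simp add: card_cube)
  next
    case (Suc j)
    let ?G = "\<lambda>\<sigma>. cube_form d (\<lambda>\<epsilon>. F (?mix (Suc j) \<sigma> \<epsilon>))"
    have upd: "?mix j \<sigma> (\<epsilon>(j := b)) = ?mix (Suc j) (\<sigma>(j := b)) \<epsilon>" for \<sigma> \<epsilon> :: "nat \<Rightarrow> nat" and b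
      by (auto simp: fun_eq_iff less_Suc_eq)
    \<comment> \<open>Fixing coordinate \<open>j\<close> to 0 and to 1 gives \<open>\<sigma>\<close>
      and its flip in some order. The flip is an involution of the cube, so both terms have the same
      sum over all \<open>\<sigma>\<close>.\<close>
    have "cube_form d (\<lambda>\<epsilon>. F (?mix j \<sigma> \<epsilon>)) \<le> (?G \<sigma> + ?G (cube_flip j \<sigma>)) / 2" if \<sigma>: "\<sigma> \<in> cube d" for \<sigma>
    proof -
      have "cube_form d (\<lambda>\<epsilon>. F (?mix j \<sigma> \<epsilon>)) \<le> (?G (\<sigma>(j := 0)) + ?G (\<sigma>(j := 1))) / 2"
        using cube_form_le_half_sum[OF d, of j "\<lambda>\<epsilon>. F (?mix j \<sigma> \<epsilon>)"] Suc.prems F mix[OF \<sigma>]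
        unfolding upd by auto
      moreover from cube_values[OF \<sigma>, of j] Suc.prems
      have "\<sigma>(j := 0) = \<sigma> \<and> \<sigma>(j := 1) = cube_flip j \<sigma> \<or> \<sigma>(j := 1) = \<sigma> \<and> \<sigma>(j := 0) = cube_flip j \<sigma>"
        by (auto simp: cube_flip_def)
      then have "?G (\<sigma>(j := 0)) + ?G (\<sigma>(j := 1)) = ?G \<sigma> + ?G (cube_flip j \<sigma>)"
        by (elim disjE conjE) (simp_all only: add.commute)
      ultimately show ?thesis by simp
    qed
    then have "(\<Sum>\<sigma>\<in>cube d. cube_form d (\<lambda>\<epsilon>. F (?mix j \<sigma> \<epsilon>))) \<le> (\<Sum>\<sigma>\<in>cube d. (?G \<sigma> + ?G (cube_flip j \<sigma>)) / 2)"
      by (rule sum_mono)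
    also have "\<dots> = ((\<Sum>\<sigma>\<in>cube d. ?G \<sigma>) + (\<Sum>\<sigma>\<in>cube d. ?G (cube_flip j \<sigma>))) / 2"
      by (simp add: sum.distrib flip: sum_divide_distrib)
    also have "(\<Sum>\<sigma>\<in>cube d. ?G (cube_flip j \<sigma>)) = (\<Sum>\<sigma>\<in>cube d. ?G \<sigma>)"
      by (rule sum.reindex_bij_witness[of _ "cube_flip j" "cube_flip j"])
        (use Suc.prems in \<open>auto simp: cube_flip_cube cube_flip_flip\<close>)
    finally have "(\<Sum>\<sigma>\<in>cube d. cube_form d (\<lambda>\<epsilon>. F (?mix j \<sigma> \<epsilon>))) \<le> (\<Sum>\<sigma>\<in>cube d. ?G \<sigma>)"
      by simp
    then have "(\<Sum>\<sigma>\<in>cube d. cube_form d (\<lambda>\<epsilon>. F (?mix j \<sigma> \<epsilon>))) / 2 ^ d \<le> (\<Sum>\<sigma>\<in>cube d. ?G \<sigma>) / 2 ^ d"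
      by (rule divide_right_mono) simp
    with Suc show ?case by simp
  qed
  from this[of d] have "cube_form d F \<le> (\<Sum>\<sigma>\<in>cube d. cube_form d (\<lambda>\<epsilon>. F (?mix d \<sigma> \<epsilon>))) / 2 ^ d"
    by simp
  moreover have "cube_form d (\<lambda>\<epsilon>. F (?mix d \<sigma> \<epsilon>)) = cube_form d (\<lambda>_. F \<sigma>)" if "\<sigma> \<in> cube d" for \<sigma>
  proof (rule cube_form_cong)
    fix \<epsilon> assume "\<epsilon> \<in> cube d"
    with that have "?mix d \<sigma> \<epsilon> = \<sigma>"
      unfolding cube_def by (auto simp: PiE_iff extensional_def fun_eq_iff)
    then show "F (?mix d \<sigma> \<epsilon>) = F \<sigma>" by simp
  qed
  ultimately show ?thesis by simp
qed

text \<open>Multilinear expansion writes the left side as a sum of mixed forms over sets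
  \<open>X\<close> of vertices, with the weights of a random set containing each vertex
  independently with probability \<open>a\<close>. Each mixed form is at most an average of pure
  ones, and a given vertex contributes \<open>a ?u + b ?v\<close> in expectation.\<close>

lemma cube_form_const_convex:
  assumes d: "d \<ge> 1" and f: "f \<in> baire_Lp (2 ^ (d - 1))" and g: "g \<in> baire_Lp (2 ^ (d - 1))"
    and ab: "a \<ge> 0" "b \<ge> 0" "a + b = 1"
  shows "cube_form d (\<lambda>_ x. a * f x + b * g x) \<le> a * cube_form d (\<lambda>_. f) + b * cube_form d (\<lambda>_. g)"
proof -
  let ?u = "cube_form d (\<lambda>_. f)" and ?v = "cube_form d (\<lambda>_. g)"
  let ?n = "2 ^ d :: real"
  let ?w = "\<lambda>X. (\<Prod>\<epsilon>\<in>X. a) * (\<Prod>\<epsilon>\<in>cube d - X. b)"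
  have "cube_form d (\<lambda>_ x. a * f x + b * g x)
      = (\<Sum>X\<in>Pow (cube d). cube_form d (\<lambda>\<epsilon>. if \<epsilon> \<in> X then (\<lambda>x. a * f x) else (\<lambda>x. b * g x)))"
    using f g by (intro cube_form_add d baire_Lp_scale)
  also have "\<dots> = (\<Sum>X\<in>Pow (cube d). ?w X * cube_form d (\<lambda>\<epsilon>. if \<epsilon> \<in> X then f else g))"
  proof (intro sum.cong refl)
    fix X assume X: "X \<in> Pow (cube d)"
    have "cube_form d (\<lambda>\<epsilon>. if \<epsilon> \<in> X then (\<lambda>x. a * f x) else (\<lambda>x. b * g x)) =
        cube_form d (\<lambda>\<epsilon> x. (if \<epsilon> \<in> X then a else b) * (if \<epsilon> \<in> X then f else g) x)"
      by (intro cube_form_cong) auto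
    also have "\<dots> = (\<Prod>\<epsilon>\<in>cube d. if \<epsilon> \<in> X then a else b) * cube_form d (\<lambda>\<epsilon>. if \<epsilon> \<in> X then f else g)"
      by (rule cube_form_scale)
    also have "(\<Prod>\<epsilon>\<in>cube d. if \<epsilon> \<in> X then a else b) = ?w X"
      using X prod.subset_diff[of X "cube d" "\<lambda>\<epsilon>. if \<epsilon> \<in> X then a else b"] by (simp add: mult.commute)
    finally show "cube_form d (\<lambda>\<epsilon>. if \<epsilon> \<in> X then (\<lambda>x. a * f x) else (\<lambda>x. b * g x)) =
      ?w X * cube_form d (\<lambda>\<epsilon>. if \<epsilon> \<in> X then f else g)" .
  qed
  also have "\<dots> \<le> (\<Sum>X\<in>Pow (cube d). ?w X * ((\<Sum>\<sigma>\<in>cube d. if \<sigma> \<in> X then ?u else ?v) / ?n))"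
  proof (intro sum_mono mult_left_mono)
    fix X
    show "cube_form d (\<lambda>\<epsilon>. if \<epsilon> \<in> X then f else g) \<le> (\<Sum>\<sigma>\<in>cube d. if \<sigma> \<in> X then ?u else ?v) / ?n"
    proof -
      have "cube_form d (\<lambda>\<epsilon>. if \<epsilon> \<in> X then f else g)
          \<le> (\<Sum>\<sigma>\<in>cube d. cube_form d (\<lambda>_. if \<sigma> \<in> X then f else g)) / ?n"
        using f g by (intro cube_form_le_average d) simp
      also have "(\<Sum>\<sigma>\<in>cube d. cube_form d (\<lambda>_. if \<sigma> \<in> X then f else g)) = (\<Sum>\<sigma>\<in>cube d. if \<sigma> \<in> X then ?u else ?v)"
        by (intro sum.cong) auto
      finally show ?thesis .
    qed
    show "0 \<le> ?w X"
      using ab by (intro mult_nonneg_nonneg prod_nonneg) auto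
  qed
  also have "\<dots> = (\<Sum>\<sigma>\<in>cube d. \<Sum>X\<in>Pow (cube d). ?w X * (if \<sigma> \<in> X then ?u else ?v)) / ?n"
    unfolding sum_divide_distrib sum_distrib_left by (subst sum.swap) simp
  also have "\<dots> = (\<Sum>\<sigma>\<in>cube d. a * ?u + b * ?v) / ?n"
  proof (intro arg_cong2[of _ _ _ _ "(/)"] sum.cong refl)
    fix \<sigma> assume \<sigma>: "\<sigma> \<in> cube d"
    have prod0: "(\<Prod>\<epsilon>\<in>Y. if \<epsilon> = \<sigma> then c * u else c) = (\<Prod>\<epsilon>\<in>Y. c)" if "\<sigma> \<notin> Y" for Y and c u :: real
      using that by (intro prod.cong) auto
    have prod1: "(\<Prod>\<epsilon>\<in>Y. if \<epsilon> = \<sigma> then c * u else c) = u * (\<Prod>\<epsilon>\<in>Y. c)"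
      if "finite Y" "\<sigma> \<in> Y" for Y and c u :: real
      using prod0[of "Y - {\<sigma>}" c u] prod.remove[OF that, of "\<lambda>\<epsilon>. if \<epsilon> = \<sigma> then c * u else c"]
        prod.remove[OF that, of "\<lambda>_. c"] by (simp del: prod_constant)
    \<comment> \<open>Absorbing \<open>?u\<close> and \<open>?v\<close> into the factor at
      \<open>\<sigma>\<close> makes the sum over \<open>X\<close> the expansion of a product of
      binomials, in which all other factors are \<open>a + b = 1\<close>.\<close>
    let ?a = "\<lambda>\<epsilon>. if \<epsilon> = \<sigma> then a * ?u else a" and ?b = "\<lambda>\<epsilon>. if \<epsilon> = \<sigma> then b * ?v else b"
    have "(\<Sum>X\<in>Pow (cube d). ?w X * (if \<sigma> \<in> X then ?u else ?v)) = (\<Sum>X\<in>Pow (cube d). (\<Prod>\<epsilon>\<in>X. ?a \<epsilon>) * (\<Prod>\<epsilon>\<in>cube d - X. ?b \<epsilon>))"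
    proof (intro sum.cong refl)
      fix X assume "X \<in> Pow (cube d)"
      then have X: "X \<subseteq> cube d" "finite X"
        by (auto intro: finite_subset[OF _ finite_cube])
      show "?w X * (if \<sigma> \<in> X then ?u else ?v) = (\<Prod>\<epsilon>\<in>X. ?a \<epsilon>) * (\<Prod>\<epsilon>\<in>cube d - X. ?b \<epsilon>)"
      proof (cases "\<sigma> \<in> X")
        case True
        then have "(\<Prod>\<epsilon>\<in>X. ?a \<epsilon>) = ?u * (\<Prod>\<epsilon>\<in>X. a)" "(\<Prod>\<epsilon>\<in>cube d - X. ?b \<epsilon>) = (\<Prod>\<epsilon>\<in>cube d - X. b)"
          using X by (intro prod1 prod0; simp)+
        with True show ?thesis by simp
      next
        case False
        then have "(\<Prod>\<epsilon>\<in>cube d - X. ?b \<epsilon>) = ?v * (\<Prod>\<epsilon>\<in>cube d - X. b)" "(\<Prod>\<epsilon>\<in>X. ?a \<epsilon>) = (\<Prod>\<epsilon>\<in>X. a)"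
          using X \<sigma> by (intro prod1 prod0; simp)+
        with False show ?thesis by simp
      qed
    qed
    also have "\<dots> = (\<Prod>\<epsilon>\<in>cube d. ?a \<epsilon> + ?b \<epsilon>)"
      by (rule prod_add[OF finite_cube, symmetric])
    also have "\<dots> = (\<Prod>\<epsilon>\<in>cube d. if \<epsilon> = \<sigma> then a * ?u + b * ?v else 1)"
      using ab(3) by (intro prod.cong) auto
    also have "\<dots> = a * ?u + b * ?v"
      using \<sigma> by (simp add: prod.delta)
    finally show "(\<Sum>X\<in>Pow (cube d). ?w X * (if \<sigma> \<in> X then ?u else ?v)) = a * ?u + b * ?v" .
  qed
  also have "\<dots> = a * ?u + b * ?v"
    by (simp add: card_cube)
  finally show ?thesis .
qed

text \<open>Flipping coordinates moves the exceptional vertex to the origin.\<close>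

lemma cube_form_single_vertex:
  assumes d: "d \<ge> 1" and f: "f \<in> baire_Lp (2 ^ (d - 1))" and g: "g \<in> baire_Lp (2 ^ (d - 1))" and "\<epsilon> \<in> cube d"
  shows "cube_form d (\<lambda>\<eta>. if \<eta> = \<epsilon> then g else f) = cube_form d (\<lambda>\<eta>. if \<eta> = origin d then g else f)"
  using assms(4)
proof (induction "card {i. i < d \<and> \<epsilon> i = 1}" arbitrary: \<epsilon>)
  case 0
  then have one: "\<epsilon> i \<noteq> 1" if "i < d" for i
    using that by auto
  have "\<epsilon> = (\<lambda>i\<in>{..<d}. 0)"
  proof (rule ext)
    fix i
    show "\<epsilon> i = (\<lambda>i\<in>{..<d}. 0) i"
      using one[of i] cube_values[OF 0(2), of i] 0(2) by (cases "i < d") (auto simp: cube_def PiE_iff extensional_def)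
  qed
  then show ?case by simp
next
  case (Suc n)
  have "{i. i < d \<and> \<epsilon> i = 1} \<noteq> {}"
    using Suc.hyps(2) by (metis card.empty nat.distinct(1))
  then obtain i where i: "i < d" "\<epsilon> i = 1"
    by blast
  have "{j. j < d \<and> cube_flip i \<epsilon> j = 1} = {j. j < d \<and> \<epsilon> j = 1} - {i}"
    using i by (auto simp: cube_flip_def)
  then have "n = card {j. j < d \<and> cube_flip i \<epsilon> j = 1}"
    using Suc.hyps(2) i by (simp add: card_Diff_singleton)
  moreover have "cube_flip i \<epsilon> \<in> cube d"
    using Suc.prems i by (intro cube_flip_cube)
  ultimately have "cube_form d (\<lambda>\<eta>. if \<eta> = cube_flip i \<epsilon> then g else f) = cube_form d (\<lambda>\<eta>. if \<eta> = origin d then g else f)"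
    by (rule Suc.hyps(1))
  moreover have "cube_form d (\<lambda>\<eta>. if cube_flip i \<eta> = cube_flip i \<epsilon> then g else f) = cube_form d (\<lambda>\<eta>. if \<eta> = cube_flip i \<epsilon> then g else f)"
    using f g by (intro cube_form_flip[OF d i(1)]) auto
  moreover have "cube_form d (\<lambda>\<eta>. if cube_flip i \<eta> = cube_flip i \<epsilon> then g else f) = cube_form d (\<lambda>\<eta>. if \<eta> = \<epsilon> then g else f)"
  proof (rule cube_form_cong)
    fix \<eta> assume "\<eta> \<in> cube d"
    then have "cube_flip i \<eta> = cube_flip i \<epsilon> \<longleftrightarrow> \<eta> = \<epsilon>"
      using cube_flip_flip i(1) Suc.prems by metis
    then show "(if cube_flip i \<eta> = cube_flip i \<epsilon> then g else f) = (if \<eta> = \<epsilon> then g else f)" by simp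
  qed
  ultimately show ?case by simp
qed

section \<open>Dual functions and derivatives\<close>

text \<open>For a Baire function the integrand is product measurable already, so completing the
  measure leaves the integral unchanged.\<close>

lemma gowers_norm_eq_cube_form:
  assumes "f \<in> borel_measurable baire"
  shows "gowers_norm M d f = root (2 ^ d) (cube_form d (\<lambda>_. f))"
proof -
  have "integral\<^sup>L (completion (cube_space d)) (cube_prod d (\<lambda>_. f)) = integral\<^sup>L (cube_space d) (cube_prod d (\<lambda>_. f))"
    using assms by (intro integral_completion cube_prod_measurable)
  moreover have "(\<lambda>(x, t). \<Prod>\<epsilon>\<in>cube d. f (x + cube_dot d \<epsilon> t)) = cube_prod d (\<lambda>_. f)"
    by (auto simp: cube_prod_def fun_eq_iff)
  ultimately show ?thesis
    unfolding gowers_norm_def cube_form_def by (simp add: cube_space_def)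
qed

lemma dual_product_measurable:
  fixes f :: "'a \<Rightarrow> real"
  assumes f: "f \<in> borel_measurable baire" and X: "(\<lambda>x. x) \<in> N \<rightarrow>\<^sub>M baire"
  shows "(\<lambda>(x, t). \<Prod>\<epsilon>\<in>cube_nz d. f (x + cube_dot d \<epsilon> t)) \<in> borel_measurable (N \<Otimes>\<^sub>M (\<Pi>\<^sub>M i\<in>{..<d}. M))"
  unfolding split_beta'
proof (intro borel_measurable_prod)
  fix \<epsilon>
  show "(\<lambda>z. f (fst z + cube_dot d \<epsilon> (snd z))) \<in> borel_measurable (N \<Otimes>\<^sub>M (\<Pi>\<^sub>M i\<in>{..<d}. M))"
    by (rule cube_factor_measurable[OF f])
      (auto intro!: measurable_compose[OF measurable_fst X] measurable_compose[OF measurable_snd measurable_component_singleton])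
qed

lemma dual_function_eq:
  assumes f: "f \<in> borel_measurable baire"
  shows "dual_function M d f x = (\<integral>t. (\<Prod>\<epsilon>\<in>cube_nz d. f (x + cube_dot d \<epsilon> t)) \<partial>(\<Pi>\<^sub>M i\<in>{..<d}. M))"
proof -
  have "(\<lambda>t. \<Prod>\<epsilon>\<in>cube_nz d. f (x + cube_dot d \<epsilon> t)) \<in> borel_measurable (\<Pi>\<^sub>M i\<in>{..<d}. M)"
    using measurable_Pair2[OF dual_product_measurable[OF f measurable_ident_baire, of d], of x] by simp
  then show ?thesis
    unfolding dual_function_def by (rule integral_completion)
qed

text \<open>The origin is the one vertex left out of the dual function, and its point is
  \<open>x\<close> itself. Pairing with \<open>g\<close> thus fills that place, and Fubini assembles
  a cube form.\<close>

lemma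
  assumes d: "d \<ge> 1" and f: "f \<in> baire_Lp (2 ^ (d - 1))" and g: "g \<in> baire_Lp (2 ^ (d - 1))"
  shows integrable_dual_function: "integrable M (\<lambda>x. g x * dual_function M d f x)"
    and integral_dual_function:
      "(\<integral>x. g x * dual_function M d f x \<partial>M) = cube_form d (\<lambda>\<epsilon>. if \<epsilon> = origin d then g else f)"
proof -
  let ?P = "\<Pi>\<^sub>M i\<in>{..<d}. M" and ?F = "\<lambda>\<epsilon>. if \<epsilon> = origin d then g else f"
  interpret P: prob_space ?P by (rule prob_PiM)
  interpret PP: pair_prob_space M ?P ..
  have "integrable (cube_space d) (cube_prod d ?F)"
    using f g by (intro integrable_cube_prod d) simp
  then have int: "integrable (M \<Otimes>\<^sub>M ?P) (cube_prod d ?F)"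
    by (simp add: cube_space_def)
  have "cube_prod d ?F (x, t) = g x * (\<Prod>\<epsilon>\<in>cube_nz d. f (x + cube_dot d \<epsilon> t))" for x t
  proof -
    have "cube_prod d ?F (x, t) = ?F (origin d) (x + cube_dot d (origin d) t) *
        (\<Prod>\<epsilon>\<in>cube d - {origin d}. ?F \<epsilon> (x + cube_dot d \<epsilon> t))"
      unfolding cube_prod_def by (subst prod.remove[OF finite_cube origin_cube]) simp
    also have "(\<Prod>\<epsilon>\<in>cube d - {origin d}. ?F \<epsilon> (x + cube_dot d \<epsilon> t)) = (\<Prod>\<epsilon>\<in>cube_nz d. f (x + cube_dot d \<epsilon> t))"
      unfolding cube_nz_def by (intro prod.cong) auto
    finally show ?thesis
      by (simp only: cube_dot_origin refl if_True add_0_right)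
  qed
  then have inner: "(\<integral>t. cube_prod d ?F (x, t) \<partial>?P) = g x * dual_function M d f x" for x
    using dual_function_eq[OF baire_LpD(1)[OF f], of d x] by simp
  show "integrable M (\<lambda>x. g x * dual_function M d f x)"
    using PP.integrable_fst'[OF int] by (simp only: inner)
  show "(\<integral>x. g x * dual_function M d f x \<partial>M) = cube_form d ?F"
    using PP.integral_fst'[OF int] unfolding cube_form_def by (simp only: inner cube_space_def)
qed

text \<open>Along a line the form is a polynomial in \<open>s\<close>. Its linear coefficient is the
  sum of the forms with \<open>g\<close> at a single vertex, and by symmetry all \<open>2^d\<close>
  of them equal the one with \<open>g\<close> at the origin.\<close>

lemma DERIV_cube_form:
  assumes d: "d \<ge> 1" and f: "f \<in> baire_Lp (2 ^ (d - 1))" and g: "g \<in> baire_Lp (2 ^ (d - 1))"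
  shows "((\<lambda>s. cube_form d (\<lambda>_ x. f x + s * g x)) has_real_derivative
    2 ^ d * (\<integral>x. g x * dual_function M d f x \<partial>M)) (at 0)"
proof -
  let ?C = "\<lambda>X. cube_form d (\<lambda>\<epsilon>. if \<epsilon> \<in> X then g else f)"
  have expand: "cube_form d (\<lambda>_ x. f x + s * g x) = (\<Sum>X\<in>Pow (cube d). s ^ card X * ?C X)" for s
  proof -
    have "cube_form d (\<lambda>_ x. f x + s * g x) = cube_form d (\<lambda>_ x. s * g x + f x)"
      by (simp add: add.commute)
    also have "\<dots> = (\<Sum>X\<in>Pow (cube d). cube_form d (\<lambda>\<epsilon>. if \<epsilon> \<in> X then (\<lambda>x. s * g x) else f))"
      using f g by (intro cube_form_add d baire_Lp_scale)
    also have "\<dots> = (\<Sum>X\<in>Pow (cube d). s ^ card X * ?C X)"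
    proof (intro sum.cong refl)
      fix X assume X: "X \<in> Pow (cube d)"
      have "cube_form d (\<lambda>\<epsilon>. if \<epsilon> \<in> X then (\<lambda>x. s * g x) else f) =
          cube_form d (\<lambda>\<epsilon> x. (if \<epsilon> \<in> X then s else 1) * (if \<epsilon> \<in> X then g else f) x)"
        by (intro cube_form_cong) auto
      also have "\<dots> = (\<Prod>\<epsilon>\<in>cube d. if \<epsilon> \<in> X then s else 1) * ?C X"
        by (rule cube_form_scale)
      also have "(\<Prod>\<epsilon>\<in>cube d. if \<epsilon> \<in> X then s else 1) = (\<Prod>\<epsilon>\<in>X. s)"
        using X by (intro prod.mono_neutral_cong_right) auto
      finally show "cube_form d (\<lambda>\<epsilon>. if \<epsilon> \<in> X then (\<lambda>x. s * g x) else f) = s ^ card X * ?C X"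
        by simp
    qed
    finally show ?thesis .
  qed
  have "((\<lambda>s. \<Sum>X\<in>Pow (cube d). s ^ card X * ?C X) has_real_derivative
      (\<Sum>X\<in>Pow (cube d). (if card X = 1 then 1 else 0) * ?C X)) (at 0)"
    by (intro DERIV_sum DERIV_cmult_right DERIV_power_at_0)
  also have "(\<Sum>X\<in>Pow (cube d). (if card X = 1 then 1 else 0) * ?C X) = (\<Sum>X\<in>(\<lambda>\<epsilon>. {\<epsilon>}) ` cube d. ?C X)"
    by (intro sum.mono_neutral_cong_right) (auto simp: card_1_singleton_iff)
  also have "\<dots> = (\<Sum>\<epsilon>\<in>cube d. ?C {\<epsilon>})"
    by (subst sum.reindex) (auto simp: inj_on_def)
  also have "\<dots> = (\<Sum>\<epsilon>\<in>cube d. \<integral>x. g x * dual_function M d f x \<partial>M)"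
    using cube_form_single_vertex[OF d f g] integral_dual_function[OF d f g] by (intro sum.cong) auto
  also have "\<dots> = 2 ^ d * (\<integral>x. g x * dual_function M d f x \<partial>M)"
    by (simp add: card_cube)
  finally show ?thesis
    by (simp only: expand)
qed

lemma integrable_power_mult_power:
  assumes f: "f \<in> baire_Lp n" and g: "g \<in> baire_Lp n" and "j \<le> n"
  shows "integrable M (\<lambda>x. g x ^ j * f x ^ (n - j))"
proof (rule Bochner_Integration.integrable_bound)
  show "integrable M (\<lambda>x. \<bar>g x\<bar> ^ n + \<bar>f x\<bar> ^ n)"
    using baire_LpD[OF f] baire_LpD[OF g] by auto
  show "(\<lambda>x. g x ^ j * f x ^ (n - j)) \<in> borel_measurable M"
    using baire_LpD[OF f] baire_LpD[OF g] by auto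
  show "AE x in M. norm (g x ^ j * f x ^ (n - j)) \<le> norm (\<bar>g x\<bar> ^ n + \<bar>f x\<bar> ^ n)"
    using power_mult_power_le[OF _ _ \<open>j \<le> n\<close>] by (intro AE_I2) (simp add: abs_mult power_abs)
qed

text \<open>The binomial theorem makes the integral a polynomial in \<open>s\<close>, whose linear
  coefficient is the claimed derivative.\<close>

lemma DERIV_integral_power:
  assumes f: "f \<in> baire_Lp n" and g: "g \<in> baire_Lp n" and n: "n \<ge> 1"
  shows "((\<lambda>s. \<integral>x. (f x + s * g x) ^ n \<partial>M) has_real_derivative
    real n * (\<integral>x. g x * f x ^ (n - 1) \<partial>M)) (at 0)"
proof -
  let ?I = "\<lambda>j. \<integral>x. g x ^ j * f x ^ (n - j) \<partial>M"
  have expand: "(\<integral>x. (f x + s * g x) ^ n \<partial>M) = (\<Sum>j\<le>n. s ^ j * (real (n choose j) * ?I j))" for s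
  proof -
    have "(\<integral>x. (f x + s * g x) ^ n \<partial>M) = (\<integral>x. (\<Sum>j\<le>n. (s ^ j * real (n choose j)) * (g x ^ j * f x ^ (n - j))) \<partial>M)"
      by (intro Bochner_Integration.integral_cong refl)
        (subst add.commute, subst binomial_ring, simp add: power_mult_distrib mult_ac)
    also have "\<dots> = (\<Sum>j\<le>n. \<integral>x. (s ^ j * real (n choose j)) * (g x ^ j * f x ^ (n - j)) \<partial>M)"
      using integrable_power_mult_power[OF f g] by (intro Bochner_Integration.integral_sum) auto
    finally show ?thesis
      by (simp add: mult.assoc)
  qed
  have "((\<lambda>s. \<Sum>j\<le>n. s ^ j * (real (n choose j) * ?I j)) has_real_derivative
      (\<Sum>j\<le>n. (if j = 1 then 1 else 0) * (real (n choose j) * ?I j))) (at 0)"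
    by (intro DERIV_sum DERIV_cmult_right DERIV_power_at_0)
  also have "(\<Sum>j\<le>n. (if j = 1 then 1 else 0) * (real (n choose j) * ?I j)) = (\<Sum>j\<le>n. if j = 1 then real (n choose j) * ?I j else 0)"
    by (intro sum.cong) auto
  also have "\<dots> = real n * (\<integral>x. g x * f x ^ (n - 1) \<partial>M)"
    using n by (simp add: sum.delta)
  finally show ?thesis
    by (simp only: expand)
qed

end

section \<open>Existence of a minimiser\<close>

lemma power_add_power_le:
  fixes a b :: real
  assumes "a \<ge> 0" "b \<ge> 0" "n \<ge> 1"
  shows "a ^ n + b ^ n \<le> (a + b) ^ n"
  using \<open>n \<ge> 1\<close>
proof (induction n rule: dec_induct)
  case (step n)
  have "a ^ Suc n + b ^ Suc n \<le> (a + b) * (a ^ n + b ^ n)"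
    using assms by (simp add: algebra_simps)
  also have "\<dots> \<le> (a + b) * (a + b) ^ n"
    using step assms by (intro mult_left_mono) auto
  finally show ?case by simp
qed simp

lemma half_sum_power_le:
  fixes a b :: real
  assumes "a \<ge> 0" "b \<ge> 0"
  shows "((a + b) / 2) ^ n \<le> (a ^ n + b ^ n) / 2"
proof -
  have "convex_on {0::real..} (\<lambda>x. x ^ n)"
    using convex_power_even[of n] convex_power_odd[of n] by (cases "even n") (auto intro: convex_on_subset)
  from convex_onD[OF this, of "1/2" a b] assms show ?thesis
    by (simp add: field_simps)
qed

text \<open>Clarkson's inequality in pointwise form. With \<open>2^k = 2q\<close>, superadditivity
  of the \<open>q\<close>-th power joins the two squares, the parallelogram law evaluates their sum,
  and convexity of the \<open>q\<close>-th power finishes.\<close>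

lemma clarkson_power:
  fixes a b :: real
  assumes "k \<ge> 1"
  shows "((a + b) / 2) ^ 2 ^ k + ((a - b) / 2) ^ 2 ^ k \<le> (a ^ 2 ^ k + b ^ 2 ^ k) / 2"
proof -
  define q where "q = (2 :: nat) ^ (k - 1)"
  have q: "(2 :: nat) ^ k = 2 * q" "q \<ge> 1"
    using assms by (auto simp: q_def simp flip: power_Suc)
  have "((a + b) / 2) ^ (2 * q) + ((a - b) / 2) ^ (2 * q) = (((a + b) / 2)\<^sup>2) ^ q + (((a - b) / 2)\<^sup>2) ^ q"
    by (simp only: power_mult)
  also have "\<dots> \<le> (((a + b) / 2)\<^sup>2 + ((a - b) / 2)\<^sup>2) ^ q"
    using q by (intro power_add_power_le) auto
  also have "((a + b) / 2)\<^sup>2 + ((a - b) / 2)\<^sup>2 = (a\<^sup>2 + b\<^sup>2) / 2"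
    by (simp add: power2_eq_square field_simps)
  also have "((a\<^sup>2 + b\<^sup>2) / 2) ^ q \<le> ((a\<^sup>2) ^ q + (b\<^sup>2) ^ q) / 2"
    by (intro half_sum_power_le) auto
  finally show ?thesis
    by (simp only: power_mult q)
qed

text \<open>
  With \<open>1 / a + 1 / b = 1\<close> a convex \<open>n\<close>-homogeneous functional satisfies
  \<open>N f \<le> (1 / a) N (a h) + (1 / b) N (b (f - h))\<close>.
\<close>

lemma convex_homogeneous_le:
  fixes N :: "('a \<Rightarrow> real) \<Rightarrow> real"
  assumes conv: "\<And>u v s t. u \<in> V \<Longrightarrow> v \<in> V \<Longrightarrow> s \<ge> 0 \<Longrightarrow> t \<ge> 0 \<Longrightarrow> s + t = 1 \<Longrightarrow>
      N (\<lambda>x. s * u x + t * v x) \<le> s * N u + t * N v"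
    and hom: "\<And>u t. u \<in> V \<Longrightarrow> N (\<lambda>x. t * u x) = t ^ n * N u"
    and scale: "\<And>u t. u \<in> V \<Longrightarrow> (\<lambda>x. t * u x) \<in> V"
    and V: "h \<in> V" "(\<lambda>x. f x - h x) \<in> V" and n: "n \<ge> 1"
    and a: "a > 1"
  shows "N f \<le> a ^ (n - 1) * N h + (a / (a - 1)) ^ (n - 1) * N (\<lambda>x. f x - h x)"
proof -
  define b where "b = a / (a - 1)"
  have b: "b > 0" "1 / a + 1 / b = 1"
    using a by (auto simp: b_def field_simps)
  have pow: "(1 / c) * c ^ n = c ^ (n - 1)" if "c > 0" for c :: real
    using that n by (cases n) auto
  have "f = (\<lambda>x. (1 / a) * (a * h x) + (1 / b) * (b * (f x - h x)))"
    using a b(1) by auto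
  then have "N f = N (\<lambda>x. (1 / a) * (a * h x) + (1 / b) * (b * (f x - h x)))"
    by (rule arg_cong)
  also have "\<dots> \<le> (1 / a) * N (\<lambda>x. a * h x) + (1 / b) * N (\<lambda>x. b * (f x - h x))"
    using a b by (intro conv scale V) auto
  also have "\<dots> = ((1 / a) * a ^ n) * N h + ((1 / b) * b ^ n) * N (\<lambda>x. f x - h x)"
    by (simp add: hom[OF V(1)] hom[OF V(2)])
  also have "\<dots> = a ^ (n - 1) * N h + b ^ (n - 1) * N (\<lambda>x. f x - h x)"
    using a b by (simp only: pow)
  finally show ?thesis
    by (simp only: b_def)
qed

lemma (in prob_space) integral_power2_le:
  assumes v: "integrable M v" "integrable M (\<lambda>x. (v x)\<^sup>2 :: real)"
  shows "(\<integral>x. v x \<partial>M)\<^sup>2 \<le> (\<integral>x. (v x)\<^sup>2 \<partial>M)"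
proof -
  have "0 \<le> variance v"
    by (intro integral_nonneg_AE) auto
  also have "variance v = (\<integral>x. (v x)\<^sup>2 \<partial>M) - (\<integral>x. v x \<partial>M)\<^sup>2"
    using v by (rule variance_eq)
  finally show ?thesis by simp
qed

section \<open>Comparison of moments and completeness\<close>

context compact_haar
begin

text \<open>Each doubling of the exponent costs one application of nonnegativity of the
  variance.\<close>

lemma baire_Lp_integral_power_le:
  assumes u: "u \<in> baire_Lp (m * 2 ^ j)"
  shows "(\<integral>x. \<bar>u x\<bar> ^ m \<partial>M) ^ 2 ^ j \<le> (\<integral>x. \<bar>u x\<bar> ^ (m * 2 ^ j) \<partial>M)"
  using u
proof (induction j)
  case (Suc j)
  have u': "u \<in> baire_Lp (m * 2 ^ j)"
    using Suc.prems baire_Lp_mono[of "m * 2 ^ j" "m * 2 ^ Suc j"] by auto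
  have sq: "(\<bar>u x\<bar> ^ (m * 2 ^ j))\<^sup>2 = \<bar>u x\<bar> ^ (m * 2 ^ Suc j)" for x
    by (simp add: mult_ac flip: power_mult)
  have "(\<integral>x. \<bar>u x\<bar> ^ m \<partial>M) ^ 2 ^ Suc j = ((\<integral>x. \<bar>u x\<bar> ^ m \<partial>M) ^ 2 ^ j)\<^sup>2"
    by (simp add: mult.commute flip: power_mult)
  also have "\<dots> \<le> (\<integral>x. \<bar>u x\<bar> ^ (m * 2 ^ j) \<partial>M)\<^sup>2"
    by (intro power_mono Suc.IH u') (auto intro!: zero_le_power integral_nonneg_AE)
  also have "\<dots> \<le> (\<integral>x. (\<bar>u x\<bar> ^ (m * 2 ^ j))\<^sup>2 \<partial>M)"
    using baire_LpD[OF u'] baire_LpD[OF Suc.prems] by (intro integral_power2_le) (auto simp: sq)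
  finally show ?case
    by (simp only: sq)
qed simp

lemma integrable_even_power:
  assumes "f \<in> baire_Lp n" "even n"
  shows "integrable M (\<lambda>x. f x ^ n)"
  using baire_LpD(3)[OF assms(1)] assms(2) by (simp add: power_even_abs)

text \<open>Smallness of the \<open>2^k\<close>-th moments makes the sequence Cauchy in
  \<open>L^1\<close>, so a subsequence converges almost everywhere. Fatou's lemma then carries the
  rate over to its limit.\<close>

lemma baire_Lp_complete:
  fixes F :: "nat \<Rightarrow> 'a \<Rightarrow> real"
  assumes F: "\<And>i. F i \<in> baire_Lp (2 ^ k)"
    and rate: "\<And>i j. i \<le> j \<Longrightarrow> (\<integral>x. \<bar>F i x - F j x\<bar> ^ 2 ^ k \<partial>M) \<le> e i"
    and e: "e \<longlonglongrightarrow> 0"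
  obtains f and r :: "nat \<Rightarrow> nat" where "f \<in> baire_Lp (2 ^ k)" "strict_mono r" "\<And>i. (\<integral>x. \<bar>f x - F (r i) x\<bar> ^ 2 ^ k \<partial>M) \<le> e (r i)"
proof -
  have F1: "integrable M (F i)" for i
  proof -
    have "F i \<in> baire_Lp 1"
      by (rule subsetD[OF baire_Lp_mono F]) simp
    from baire_LpD(2,3)[OF this] show ?thesis
      by (simp add: integrable_abs_iff)
  qed
  have "\<exists>N. \<forall>i\<ge>N. \<forall>j\<ge>N. (\<integral>x. norm (F i x - F j x) \<partial>M) < \<eta>" if \<eta>: "\<eta> > 0" for \<eta>
  proof -
    have "eventually (\<lambda>i. e i < \<eta> ^ 2 ^ k) sequentially"
      using \<eta> by (intro order_tendstoD(2)[OF e]) auto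
    then obtain N where N: "\<And>i. i \<ge> N \<Longrightarrow> e i < \<eta> ^ 2 ^ k"
      by (auto simp: eventually_sequentially)
    have *: "(\<integral>x. \<bar>F i x - F j x\<bar> \<partial>M) < \<eta>" if "i \<ge> N" "i \<le> j" for i j
    proof -
      have "(\<integral>x. \<bar>F i x - F j x\<bar> \<partial>M) ^ 2 ^ k \<le> (\<integral>x. \<bar>F i x - F j x\<bar> ^ 2 ^ k \<partial>M)"
        using baire_Lp_integral_power_le[of "\<lambda>x. F i x - F j x" 1 k] F by (simp add: baire_Lp_diff)
      also have "\<dots> < \<eta> ^ 2 ^ k"
        using rate[OF that(2)] N[OF that(1)] by simp
      finally show ?thesis
        by (rule power_less_imp_less_base) (use \<eta> in simp)
    qed
    show ?thesis
    proof (intro exI[of _ N] allI impI)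
      fix i j assume "i \<ge> N" "j \<ge> N"
      then show "(\<integral>x. norm (F i x - F j x) \<partial>M) < \<eta>"
        using *[of i j] *[of j i] abs_minus_commute[of "F j _" "F i _"] by (cases "i \<le> j") simp_all
    qed
  qed
  from cauchy_L1_AE_cauchy_subseq[OF F1 this] obtain r
    where r: "strict_mono r" "AE x in M. Cauchy (\<lambda>i. F (r i) x)" by blast
  \<comment> \<open>Taking \<open>lim\<close> at every point, whatever its value where the sequence
    diverges, keeps the limit Baire measurable.\<close>
  define f where "f x = lim (\<lambda>i. F (r i) x)" for x
  have fm: "f \<in> borel_measurable baire"
    unfolding f_def[abs_def] by (intro borel_measurable_lim_metric baire_LpD(1)[OF F])
  note fM = baire_measurable_M[OF fm]
  have lim: "AE x in M. (\<lambda>i. F (r i) x) \<longlonglongrightarrow> f x"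
    using r(2) by eventually_elim (simp add: f_def Cauchy_convergent_iff convergent_LIMSEQ_iff)
  have e0: "e i \<ge> 0" for i
    by (rule order.trans[OF integral_nonneg_AE rate[of i i]]) auto
  have fatou: "(\<integral>\<^sup>+x. ennreal (\<bar>f x - F (r i) x\<bar> ^ 2 ^ k) \<partial>M) \<le> ennreal (e (r i))" for i
  proof -
    have "AE x in M. ennreal (\<bar>f x - F (r i) x\<bar> ^ 2 ^ k) = liminf (\<lambda>j. ennreal (\<bar>F (r i) x - F (r j) x\<bar> ^ 2 ^ k))"
      using lim
    proof eventually_elim
      case (elim x)
      have "(\<lambda>j. ennreal (\<bar>F (r i) x - F (r j) x\<bar> ^ 2 ^ k)) \<longlonglongrightarrow> ennreal (\<bar>F (r i) x - f x\<bar> ^ 2 ^ k)"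
        by (intro tendsto_ennrealI tendsto_intros elim)
      from lim_imp_Liminf[OF _ this] show ?case
        by (simp add: abs_minus_commute)
    qed
    then have "(\<integral>\<^sup>+x. ennreal (\<bar>f x - F (r i) x\<bar> ^ 2 ^ k) \<partial>M)
        = (\<integral>\<^sup>+x. liminf (\<lambda>j. ennreal (\<bar>F (r i) x - F (r j) x\<bar> ^ 2 ^ k)) \<partial>M)"
      by (rule nn_integral_cong_AE)
    also have "\<dots> \<le> liminf (\<lambda>j. \<integral>\<^sup>+x. ennreal (\<bar>F (r i) x - F (r j) x\<bar> ^ 2 ^ k) \<partial>M)"
    proof (rule nn_integral_liminf)
      show "(\<lambda>x. ennreal (\<bar>F (r i) x - F (r j) x\<bar> ^ 2 ^ k)) \<in> borel_measurable M" for j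
        using baire_LpD(2)[OF F[of "r i"]] baire_LpD(2)[OF F[of "r j"]] by measurable
    qed
    also have "\<dots> \<le> ennreal (e (r i))"
    proof (rule Liminf_le)
      show "eventually (\<lambda>j. (\<integral>\<^sup>+x. ennreal (\<bar>F (r i) x - F (r j) x\<bar> ^ 2 ^ k) \<partial>M) \<le> ennreal (e (r i))) sequentially"
        using eventually_ge_at_top[of i]
      proof eventually_elim
        case (elim j)
        have "(\<integral>\<^sup>+x. ennreal (\<bar>F (r i) x - F (r j) x\<bar> ^ 2 ^ k) \<partial>M) = ennreal (\<integral>x. \<bar>F (r i) x - F (r j) x\<bar> ^ 2 ^ k \<partial>M)"
          using baire_LpD(3)[OF baire_Lp_diff[OF F[of "r i"] F[of "r j"]]] by (intro nn_integral_eq_integral) auto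
        also have "\<dots> \<le> ennreal (e (r i))"
          using rate[of "r i" "r j"] r(1) elim by (intro ennreal_leI) (auto simp: strict_mono_less_eq)
        finally show ?case .
      qed
    qed simp
    finally show ?thesis .
  qed
  have int: "integrable M (\<lambda>x. \<bar>f x - F (r i) x\<bar> ^ 2 ^ k)" for i
  proof (rule integrableI_bounded)
    show "(\<lambda>x. \<bar>f x - F (r i) x\<bar> ^ 2 ^ k) \<in> borel_measurable M"
      using fM baire_LpD(2)[OF F[of "r i"]] by measurable
    show "(\<integral>\<^sup>+x. ennreal (norm (\<bar>f x - F (r i) x\<bar> ^ 2 ^ k)) \<partial>M) < \<infinity>"
      using le_less_trans[OF fatou ennreal_less_top] by simp
  qed
  have diff: "(\<lambda>x. f x - F (r i) x) \<in> baire_Lp (2 ^ k)" for i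
    using int[of i] fm baire_LpD(1)[OF F[of "r i"]] by (auto simp: baire_Lp_def)
  show ?thesis
  proof (rule that)
    show "f \<in> baire_Lp (2 ^ k)"
      using baire_Lp_add[OF diff[of 0] F[of "r 0"]] by simp
    show "strict_mono r" by fact
    show "(\<integral>x. \<bar>f x - F (r i) x\<bar> ^ 2 ^ k \<partial>M) \<le> e (r i)" for i
      using fatou[of i] int[of i] e0 by (subst (asm) nn_integral_eq_integral) auto
  qed
qed

text \<open>The denominators cancel the factors \<open>2^d\<close> and \<open>2^k\<close> produced
  by differentiation, so that the critical equation has coefficients 1 and \<open>c\<close>.\<close>

definition energy :: "nat \<Rightarrow> nat \<Rightarrow> real \<Rightarrow> ('a \<Rightarrow> real) \<Rightarrow> ('a \<Rightarrow> real) \<Rightarrow> real" where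
  "energy d k c g f = cube_form d (\<lambda>_. f) / 2 ^ d + c / 2 ^ k * (\<integral>x. f x ^ 2 ^ k \<partial>M) - (\<integral>x. g x * f x \<partial>M)"

section \<open>Minimisation for a pairing dominated by the Gowers form\<close>

context
  fixes d k :: nat and c :: real and g :: "'a \<Rightarrow> real"
  assumes d: "d \<ge> 1" and k: "k \<ge> 1" and dk: "d - 1 \<le> k" and c: "c > 0"
    and g_int: "\<And>f. f \<in> baire_Lp (2 ^ k) \<Longrightarrow> integrable M (\<lambda>x. g x * f x)"
    and g_le: "\<And>f. f \<in> baire_Lp (2 ^ k) \<Longrightarrow> \<bar>\<integral>x. g x * f x \<partial>M\<bar> ^ 2 ^ d \<le> cube_form d (\<lambda>_. f)"
begin

lemma Lp_sub: "f \<in> baire_Lp (2 ^ k) \<Longrightarrow> f \<in> baire_Lp (2 ^ (d - 1))"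
  using baire_Lp_mono[of "2 ^ (d - 1)" "2 ^ k"] dk by (auto intro: power_increasing)

text \<open>With \<open>n = 2^d\<close>, Bernoulli's inequality gives
  \<open>l - 1 \<le> l^n / n\<close>, so the Gowers term absorbs the linear term up to 1.\<close>

lemma energy_ge: "f \<in> baire_Lp (2 ^ k) \<Longrightarrow> energy d k c g f \<ge> - 1"
proof -
  assume f: "f \<in> baire_Lp (2 ^ k)"
  define l where "l = \<bar>\<integral>x. g x * f x \<partial>M\<bar>"
  have "1 + real (2 ^ d) * (l - 1) \<le> (1 + (l - 1)) ^ 2 ^ d"
    by (rule Bernoulli_inequality) (simp add: l_def)
  also have "\<dots> \<le> cube_form d (\<lambda>_. f)"
    using g_le[OF f] by (simp add: l_def)
  finally have "l - 1 \<le> cube_form d (\<lambda>_. f) / 2 ^ d"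
    by (simp add: field_simps)
  moreover have "0 \<le> c / 2 ^ k * (\<integral>x. f x ^ 2 ^ k \<partial>M)"
    using c k by (intro mult_nonneg_nonneg integral_nonneg_AE) (auto simp: zero_le_even_power)
  moreover have "(\<integral>x. g x * f x \<partial>M) \<le> l"
    by (simp add: l_def)
  ultimately show ?thesis
    unfolding energy_def by linarith
qed

text \<open>Clarkson's inequality gives the gain in the power term, the Gowers term is convex and
  the pairing is linear. Since the midpoint cannot lie below the infimum, near-minimisers must be
  close to each other.\<close>

lemma energy_midpoint:
  assumes f: "f \<in> baire_Lp (2 ^ k)" and h: "h \<in> baire_Lp (2 ^ k)"
  shows "c / 2 ^ k * (\<integral>x. \<bar>f x - h x\<bar> ^ 2 ^ k \<partial>M) / 2 ^ 2 ^ k \<le>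
    (energy d k c g f + energy d k c g h) / 2 - energy d k c g (\<lambda>x. (1/2) * f x + (1/2) * h x)"
proof -
  have ev: "even ((2::nat) ^ k)"
    using k by simp
  have m: "(\<lambda>x. (1/2) * f x + (1/2) * h x) \<in> baire_Lp (2 ^ k)"
    by (intro baire_Lp_add baire_Lp_scale f h)
  note dm = baire_Lp_diff[OF f h]
  have U: "cube_form d (\<lambda>_ x. (1/2) * f x + (1/2) * h x) \<le> (1/2) * cube_form d (\<lambda>_. f) + (1/2) * cube_form d (\<lambda>_. h)"
    using f h by (intro cube_form_const_convex d Lp_sub) auto
  have L: "(\<integral>x. g x * ((1/2) * f x + (1/2) * h x) \<partial>M) = (1/2) * (\<integral>x. g x * f x \<partial>M) + (1/2) * (\<integral>x. g x * h x \<partial>M)"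
    using g_int[OF f] g_int[OF h] by (simp add: algebra_simps add_divide_distrib)
  have "(\<integral>x. ((1/2) * f x + (1/2) * h x) ^ 2 ^ k + (f x - h x) ^ 2 ^ k / 2 ^ 2 ^ k \<partial>M) \<le> (\<integral>x. (f x ^ 2 ^ k + h x ^ 2 ^ k) / 2 \<partial>M)"
  proof (rule integral_mono)
    show "((1/2) * f x + (1/2) * h x) ^ 2 ^ k + (f x - h x) ^ 2 ^ k / 2 ^ 2 ^ k \<le> (f x ^ 2 ^ k + h x ^ 2 ^ k) / 2" for x
      using clarkson_power[OF k, of "f x" "h x"] by (simp add: power_divide add_divide_distrib)
  qed (use integrable_even_power[OF _ ev] f h m dm in auto)
  then have K: "(\<integral>x. ((1/2) * f x + (1/2) * h x) ^ 2 ^ k \<partial>M) + (\<integral>x. \<bar>f x - h x\<bar> ^ 2 ^ k \<partial>M) / 2 ^ 2 ^ k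
      \<le> ((\<integral>x. f x ^ 2 ^ k \<partial>M) + (\<integral>x. h x ^ 2 ^ k \<partial>M)) / 2"
    using integrable_even_power[OF f ev] integrable_even_power[OF h ev] integrable_even_power[OF m ev] integrable_even_power[OF dm ev]
    by (simp add: power_even_abs[OF ev])
  have "c / 2 ^ k * ((\<integral>x. ((1/2) * f x + (1/2) * h x) ^ 2 ^ k \<partial>M) + (\<integral>x. \<bar>f x - h x\<bar> ^ 2 ^ k \<partial>M) / 2 ^ 2 ^ k)
      \<le> c / 2 ^ k * (((\<integral>x. f x ^ 2 ^ k \<partial>M) + (\<integral>x. h x ^ 2 ^ k \<partial>M)) / 2)"
    using c by (intro mult_left_mono K) auto
  moreover have "cube_form d (\<lambda>_ x. (1/2) * f x + (1/2) * h x) / 2 ^ d \<le> ((1/2) * cube_form d (\<lambda>_. f) + (1/2) * cube_form d (\<lambda>_. h)) / 2 ^ d"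
    using U by (intro divide_right_mono) auto
  moreover have "cc * dd / pp \<le> ((uf / n + cc * kf - lf) + (uh / n + cc * kh - lh)) / 2
        - (um / n + cc * km - ((1/2) * lf + (1/2) * lh))"
    if "cc * (km + dd / pp) \<le> cc * ((kf + kh) / 2)" "um / n \<le> ((1/2) * uf + (1/2) * uh) / n"
    for cc km dd pp kf kh um uf uh n lf lh :: real
  proof -
    have "((1/2) * uf + (1/2) * uh) / n = (uf / n + uh / n) / 2" "cc * (km + dd / pp) = cc * km + cc * dd / pp"
      "cc * ((kf + kh) / 2) = (cc * kf + cc * kh) / 2"
      by (simp_all add: add_divide_distrib distrib_left)
    with that have "cc * km + cc * dd / pp \<le> (cc * kf + cc * kh) / 2" "um / n \<le> (uf / n + uh / n) / 2"
      by (simp_all only:)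
    then show ?thesis by argo
  qed
  ultimately show ?thesis
    unfolding energy_def L by blast
qed

text \<open>The antipodal estimate bounds the form by \<open>2^(d-1)\<close>-th moments, and
  \<open>d - 1 \<le> k\<close> lets the \<open>2^k\<close>-th moments control these.\<close>

lemma cube_form_tendsto_0:
  assumes u: "\<And>i. u i \<in> baire_Lp (2 ^ k)" and lim: "(\<lambda>i. \<integral>x. \<bar>u i x\<bar> ^ 2 ^ k \<partial>M) \<longlonglongrightarrow> 0"
  shows "(\<lambda>i. cube_form d (\<lambda>_. u i)) \<longlonglongrightarrow> 0"
proof -
  define j where "j = k - (d - 1)"
  have exp: "(2 :: nat) ^ (d - 1) * 2 ^ j = 2 ^ k"
    using dk by (simp add: j_def flip: power_add)
  let ?I = "\<lambda>i. \<integral>x. \<bar>u i x\<bar> ^ 2 ^ (d - 1) \<partial>M"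
  have I0: "?I i \<ge> 0" for i
    by (intro integral_nonneg_AE) auto
  have "?I i ^ 2 ^ j \<le> (\<integral>x. \<bar>u i x\<bar> ^ 2 ^ k \<partial>M)" for i
    using baire_Lp_integral_power_le[of "u i" "2 ^ (d - 1)" j] u[of i] unfolding exp by simp
  then have "(\<lambda>i. ?I i ^ 2 ^ j) \<longlonglongrightarrow> 0"
    using I0 by (intro tendsto_sandwich[OF _ _ tendsto_const lim] always_eventually allI zero_le_power)
  then have I: "?I \<longlonglongrightarrow> 0"
    by (subst (asm) power_tendsto_0_iff) simp_all
  have "(\<lambda>i. \<Sum>\<epsilon>\<in>cube d. ?I i * ?I i) \<longlonglongrightarrow> (\<Sum>\<epsilon>\<in>cube d. 0 * 0)"
    by (intro tendsto_sum tendsto_mult I)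
  then have lim0: "(\<lambda>i. \<Sum>\<epsilon>\<in>cube d. ?I i * ?I i) \<longlonglongrightarrow> 0"
    by simp
  have "norm (cube_form d (\<lambda>_. u i)) \<le> (\<Sum>\<epsilon>\<in>cube d. ?I i * ?I i)" for i
    using abs_cube_form_le[OF d, of "\<lambda>_. u i", OF Lp_sub[OF u]] by (simp only: real_norm_def)
  then show ?thesis
    by (intro Lim_null_comparison[OF always_eventually lim0]) blast
qed

lemma integral_power_le:
  assumes f: "f \<in> baire_Lp (2 ^ k)" and h: "h \<in> baire_Lp (2 ^ k)" and a: "a > 1"
  shows "(\<integral>x. f x ^ 2 ^ k \<partial>M) \<le> a ^ (2 ^ k - 1) * (\<integral>x. h x ^ 2 ^ k \<partial>M) +
    (a / (a - 1)) ^ (2 ^ k - 1) * (\<integral>x. \<bar>f x - h x\<bar> ^ 2 ^ k \<partial>M)"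
proof -
  let ?V = "baire_Lp (2 ^ k)" and ?N = "\<lambda>f. \<integral>x. f x ^ 2 ^ k \<partial>M"
  have ev: "even ((2::nat) ^ k)"
    using k by simp
  have "?N f \<le> a ^ (2 ^ k - 1) * ?N h + (a / (a - 1)) ^ (2 ^ k - 1) * ?N (\<lambda>x. f x - h x)"
  proof (rule convex_homogeneous_le[where V = ?V and N = ?N])
    fix u v and s t :: real
    assume uv: "u \<in> ?V" "v \<in> ?V" and st: "s \<ge> 0" "t \<ge> 0" "s + t = 1"
    have "(\<integral>x. (s * u x + t * v x) ^ 2 ^ k \<partial>M) \<le> (\<integral>x. s * u x ^ 2 ^ k + t * v x ^ 2 ^ k \<partial>M)"
    proof (rule integral_mono)
      show "integrable M (\<lambda>x. (s * u x + t * v x) ^ 2 ^ k)"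
        using uv by (intro integrable_even_power baire_Lp_add baire_Lp_scale ev)
      show "integrable M (\<lambda>x. s * u x ^ 2 ^ k + t * v x ^ 2 ^ k)"
        using uv integrable_even_power[OF _ ev] by auto
      have s: "s = 1 - t" using st by simp
      show "(s * u x + t * v x) ^ 2 ^ k \<le> s * u x ^ 2 ^ k + t * v x ^ 2 ^ k" for x
        using convex_onD[OF convex_power_even[OF ev], of t "u x" "v x"] st(1,2) unfolding s by simp
    qed
    also have "\<dots> = s * ?N u + t * ?N v"
      using uv integrable_even_power[OF _ ev] by simp
    finally show "(\<integral>x. (s * u x + t * v x) ^ 2 ^ k \<partial>M) \<le> s * ?N u + t * ?N v" .
  qed (use f h a in \<open>auto simp: power_mult_distrib baire_Lp_scale baire_Lp_diff\<close>)
  then show ?thesis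
    by (simp add: power_even_abs[OF ev])
qed

lemma cube_form_const_le:
  assumes f: "f \<in> baire_Lp (2 ^ k)" and h: "h \<in> baire_Lp (2 ^ k)" and a: "a > 1"
  shows "cube_form d (\<lambda>_. f) \<le> a ^ (2 ^ d - 1) * cube_form d (\<lambda>_. h) +
    (a / (a - 1)) ^ (2 ^ d - 1) * cube_form d (\<lambda>_ x. f x - h x)"
proof (rule convex_homogeneous_le[where V = "baire_Lp (2 ^ k)" and N = "\<lambda>f. cube_form d (\<lambda>_. f)"])
  show "cube_form d (\<lambda>_ x. t * u x) = t ^ 2 ^ d * cube_form d (\<lambda>_. u)" for t u
    using cube_form_scale[of d "\<lambda>_. t" "\<lambda>_. u"] by (simp add: card_cube)
  show "cube_form d (\<lambda>_ x. s * u x + t * v x) \<le> s * cube_form d (\<lambda>_. u) + t * cube_form d (\<lambda>_. v)"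
    if "u \<in> baire_Lp (2 ^ k)" "v \<in> baire_Lp (2 ^ k)" "s \<ge> 0" "t \<ge> 0" "s + t = 1" for u v and s t :: real
    using that by (intro cube_form_const_convex d Lp_sub)
qed (use f h a in \<open>auto simp: baire_Lp_scale baire_Lp_diff\<close>)

lemma energy_minimiser_exists:
  obtains f where "f \<in> baire_Lp (2 ^ k)" "\<And>h. h \<in> baire_Lp (2 ^ k) \<Longrightarrow> energy d k c g f \<le> energy d k c g h"
proof -
  let ?V = "baire_Lp (2 ^ k)" and ?E = "energy d k c g"
  let ?U = "\<lambda>f. cube_form d (\<lambda>_. f)" and ?K = "\<lambda>f. \<integral>x. f x ^ 2 ^ k \<partial>M" and ?L = "\<lambda>f. \<integral>x. g x * f x \<partial>M"
  let ?A = "\<lambda>f. \<integral>x. \<bar>f x\<bar> ^ 2 ^ k \<partial>M"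
  define J where "J = Inf (?E ` ?V)"
  have ev: "even ((2::nat) ^ k)"
    using k by simp
  have ne: "?V \<noteq> {}"
    using baire_Lp_bounded[of "\<lambda>_. 0" 0 "2 ^ k"] by auto
  have bdd: "bdd_below (?E ` ?V)"
    using energy_ge by (intro bdd_belowI[of _ "-1"]) auto
  have J: "J \<le> ?E h" if "h \<in> ?V" for h
    unfolding J_def using bdd that by (intro cInf_lower) auto
  have "\<exists>f\<in>?V. ?E f < J + inverse (real (Suc i))" for i
    using cInf_lessD[of "?E ` ?V" "J + inverse (real (Suc i))"] ne by (auto simp: J_def)
  then obtain F where F: "\<And>i. F i \<in> ?V" "\<And>i. ?E (F i) < J + inverse (real (Suc i))"
    by metis
  \<comment> \<open>The reciprocal of the constant in front of the distance in
    \<open>energy_midpoint\<close>.\<close>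
  define C where "C = 2 ^ k / c * 2 ^ 2 ^ k"
  have C: "C > 0"
    using c by (simp add: C_def)
  have rate: "(\<integral>x. \<bar>F i x - F j x\<bar> ^ 2 ^ k \<partial>M) \<le> C * inverse (real (Suc i))" if "i \<le> j" for i j
  proof -
    have "inverse (real (Suc j)) \<le> inverse (real (Suc i))"
      using that by (intro le_imp_inverse_le) auto
    then have "(?E (F i) + ?E (F j)) / 2 - ?E (\<lambda>x. (1/2) * F i x + (1/2) * F j x) \<le> inverse (real (Suc i))"
      using F(2)[of i] F(2)[of j] J[OF baire_Lp_add[OF baire_Lp_scale[OF F(1)[of i], of "1/2"] baire_Lp_scale[OF F(1)[of j], of "1/2"]]]
      by argo
    with energy_midpoint[OF F(1)[of i] F(1)[of j]]
    have "c / 2 ^ k * (\<integral>x. \<bar>F i x - F j x\<bar> ^ 2 ^ k \<partial>M) / 2 ^ 2 ^ k \<le> inverse (real (Suc i))"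
      by linarith
    then have "C * (c / 2 ^ k * (\<integral>x. \<bar>F i x - F j x\<bar> ^ 2 ^ k \<partial>M) / 2 ^ 2 ^ k) \<le> C * inverse (real (Suc i))"
      using C by (intro mult_left_mono) auto
    moreover have "C * (c / 2 ^ k * X / 2 ^ 2 ^ k) = X" for X
      using c by (simp add: C_def)
    ultimately show ?thesis by simp
  qed
  have "(\<lambda>i. C * inverse (real (Suc i))) \<longlonglongrightarrow> 0"
    using tendsto_mult_right_zero[OF LIMSEQ_inverse_real_of_nat] by simp
  from baire_Lp_complete[OF F(1) rate this]
  obtain f and r :: "nat \<Rightarrow> nat" where f: "f \<in> ?V" "strict_mono r"
      and fr: "\<And>i. (\<integral>x. \<bar>f x - F (r i) x\<bar> ^ 2 ^ k \<partial>M) \<le> C * inverse (real (Suc (r i)))" by blast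
  define G where "G i = F (r i)" for i :: nat
  have G: "G i \<in> ?V" "(\<lambda>x. f x - G i x) \<in> ?V" for i
    unfolding G_def by (intro F baire_Lp_diff f)+
  have A: "(\<lambda>i. ?A (\<lambda>x. f x - G i x)) \<longlonglongrightarrow> 0"
  proof (rule tendsto_sandwich[OF _ _ tendsto_const])
    show "\<forall>\<^sub>F i in sequentially. 0 \<le> ?A (\<lambda>x. f x - G i x)"
      by (intro always_eventually allI integral_nonneg_AE) auto
    show "\<forall>\<^sub>F i in sequentially. ?A (\<lambda>x. f x - G i x) \<le> C * inverse (real (Suc (r i)))"
      using fr by (auto simp: G_def)
    show "(\<lambda>i. C * inverse (real (Suc (r i)))) \<longlonglongrightarrow> 0"
      using LIMSEQ_subseq_LIMSEQ[OF tendsto_mult_right_zero[OF LIMSEQ_inverse_real_of_nat] f(2), of C]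
      by (simp add: o_def)
  qed
  have U: "(\<lambda>i. ?U (\<lambda>x. f x - G i x)) \<longlonglongrightarrow> 0"
    by (rule cube_form_tendsto_0[OF G(2) A])
  \<comment> \<open>Continuity of the pairing comes from its domination by the Gowers form.\<close>
  have "(\<lambda>i. ?L (\<lambda>x. f x - G i x)) \<longlonglongrightarrow> 0"
  proof -
    have "(\<lambda>i. \<bar>?L (\<lambda>x. f x - G i x)\<bar> ^ 2 ^ d) \<longlonglongrightarrow> 0"
      using g_le[OF G(2)] by (intro tendsto_sandwich[OF _ _ tendsto_const U]) auto
    then show ?thesis
      by (simp add: tendsto_rabs_zero_iff)
  qed
  moreover have "?L (\<lambda>x. f x - G i x) = ?L f - ?L (G i)" for i
    using g_int[OF f(1)] g_int[OF G(1)[of i]] by (simp add: right_diff_distrib)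
  ultimately have "(\<lambda>i. ?L f - (?L f - ?L (G i))) \<longlonglongrightarrow> ?L f - 0"
    by (intro tendsto_diff tendsto_const) simp
  then have L: "(\<lambda>i. ?L (G i)) \<longlonglongrightarrow> ?L f"
    by simp
  have EG: "(\<lambda>i. ?E (G i)) \<longlonglongrightarrow> J"
  proof (rule tendsto_sandwich[OF _ _ tendsto_const])
    show "\<forall>\<^sub>F i in sequentially. J \<le> ?E (G i)"
      using J G by auto
    show "\<forall>\<^sub>F i in sequentially. ?E (G i) \<le> J + inverse (real (Suc (r i)))"
      using F(2) by (auto simp: G_def less_imp_le)
    show "(\<lambda>i. J + inverse (real (Suc (r i)))) \<longlonglongrightarrow> J"
      using LIMSEQ_subseq_LIMSEQ[OF LIMSEQ_inverse_real_of_nat_add[of J] f(2)] by (simp add: o_def)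
  qed
  define P where "P h = ?U h / 2 ^ d + c / 2 ^ k * ?K h" for h
  have P: "P h = ?E h + ?L h" for h
    by (simp add: P_def energy_def)
  \<comment> \<open>Lower semicontinuity of the homogeneous terms. For fixed \<open>a\<close> the
    errors, multiplied by powers of \<open>a / (a - 1)\<close>, vanish as \<open>i\<close> grows;
    only afterwards does \<open>a\<close> tend to 1. The exponent \<open>2^d + 2^k\<close> is a
    common upper bound for those of the two terms.\<close>
  have bound: "P f \<le> a ^ (2 ^ d + 2 ^ k) * (J + ?L f)" if a: "a > 1" for a
  proof -
    let ?q = "2 ^ d + 2 ^ k :: nat" and ?b = "a / (a - 1)"
    have step: "P f \<le> a ^ ?q * (?E (G i) + ?L (G i)) +
        (?b ^ (2 ^ d - 1) * ?U (\<lambda>x. f x - G i x) / 2 ^ d + c / 2 ^ k * (?b ^ (2 ^ k - 1) * ?A (\<lambda>x. f x - G i x)))" for i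
    proof -
      have "?U f \<le> a ^ (2 ^ d - 1) * ?U (G i) + ?b ^ (2 ^ d - 1) * ?U (\<lambda>x. f x - G i x)"
        by (rule cube_form_const_le[OF f(1) G(1) a])
      also have "a ^ (2 ^ d - 1) * ?U (G i) \<le> a ^ ?q * ?U (G i)"
        using a by (intro mult_right_mono power_increasing cube_form_const_nonneg d Lp_sub G) auto
      finally have "?U f / 2 ^ d \<le> (a ^ ?q * ?U (G i) + ?b ^ (2 ^ d - 1) * ?U (\<lambda>x. f x - G i x)) / 2 ^ d"
        by (intro divide_right_mono) auto
      then have 1: "?U f / 2 ^ d \<le> a ^ ?q * (?U (G i) / 2 ^ d) + ?b ^ (2 ^ d - 1) * ?U (\<lambda>x. f x - G i x) / 2 ^ d"
        by (simp add: add_divide_distrib)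
      have "?K f \<le> a ^ (2 ^ k - 1) * ?K (G i) + ?b ^ (2 ^ k - 1) * ?A (\<lambda>x. f x - G i x)"
        by (rule integral_power_le[OF f(1) G(1) a])
      also have "a ^ (2 ^ k - 1) * ?K (G i) \<le> a ^ ?q * ?K (G i)"
        using a ev by (intro mult_right_mono power_increasing integral_nonneg_AE) (auto simp: zero_le_even_power)
      finally have "c / 2 ^ k * ?K f \<le> c / 2 ^ k * (a ^ ?q * ?K (G i) + ?b ^ (2 ^ k - 1) * ?A (\<lambda>x. f x - G i x))"
        using c by (intro mult_left_mono) auto
      then have 2: "c / 2 ^ k * ?K f \<le> a ^ ?q * (c / 2 ^ k * ?K (G i)) + c / 2 ^ k * (?b ^ (2 ^ k - 1) * ?A (\<lambda>x. f x - G i x))"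
        by (simp add: algebra_simps)
      have "a ^ ?q * (?E (G i) + ?L (G i)) = a ^ ?q * (?U (G i) / 2 ^ d) + a ^ ?q * (c / 2 ^ k * ?K (G i))"
        unfolding P[symmetric] unfolding P_def by (rule distrib_left)
      with 1 2 show ?thesis
        unfolding P_def[of f] by linarith
    qed
    have "(\<lambda>i. a ^ ?q * (?E (G i) + ?L (G i)) +
        (?b ^ (2 ^ d - 1) * ?U (\<lambda>x. f x - G i x) / 2 ^ d + c / 2 ^ k * (?b ^ (2 ^ k - 1) * ?A (\<lambda>x. f x - G i x))))
      \<longlonglongrightarrow> a ^ ?q * (J + ?L f) + (?b ^ (2 ^ d - 1) * 0 / 2 ^ d + c / 2 ^ k * (?b ^ (2 ^ k - 1) * 0))"
      by (intro tendsto_intros EG L U A) auto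
    then have "P f \<le> a ^ ?q * (J + ?L f) + (?b ^ (2 ^ d - 1) * 0 / 2 ^ d + c / 2 ^ k * (?b ^ (2 ^ k - 1) * 0))"
      using step by (intro LIMSEQ_le_const) auto
    then show ?thesis by simp
  qed
  have "(\<lambda>i. (1 + inverse (real (Suc i))) ^ (2 ^ d + 2 ^ k) * (J + ?L f)) \<longlonglongrightarrow> 1 ^ (2 ^ d + 2 ^ k) * (J + ?L f)"
    by (intro tendsto_intros LIMSEQ_inverse_real_of_nat_add)
  then have "P f \<le> 1 ^ (2 ^ d + 2 ^ k) * (J + ?L f)"
    using bound by (intro LIMSEQ_le_const) auto
  then have "?E f \<le> J"
    using P[of f] by simp
  then show ?thesis
    using that[OF f(1)] J by (meson order.trans)
qed

end

end

section \<open>Lebesgue norms and the dual norm\<close>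

lemma enn2real_two_power: "enn2real (2 ^ k) = 2 ^ k"
  using enn2real_ennreal[of "2 ^ k"] ennreal_power[of 2 k] by simp

lemma two_power_neq_infinity: "(2 ^ k :: ennreal) \<noteq> \<infinity>"
  using ennreal_power[of 2 k] by (metis ennreal_neq_top ennreal_numeral infinity_ennreal_def zero_le_numeral)

lemma conjugate_exponent:
  assumes "k \<ge> 1"
  shows "(2 ^ k / (2 ^ k - 1) :: ennreal) = ennreal (2 ^ k / (2 ^ k - 1))"
proof -
  have "(2 :: real) ^ k > 1"
    using assms by (intro one_less_power) auto
  moreover have "(2 ^ k :: ennreal) = ennreal (2 ^ k)"
    using ennreal_power[of 2 k] by simp
  ultimately show ?thesis
    using ennreal_minus[of 1 "2 ^ k"] divide_ennreal[of "2 ^ k" "2 ^ k - 1"] by (simp del: ennreal_minus)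
qed

lemma powr_two_power: "x \<ge> 0 \<Longrightarrow> x powr 2 ^ k = (x ^ 2 ^ k :: real)"
  using powr_realpow'[of x "2 ^ k"] by simp

context compact_haar
begin

lemma prob_UNIV [simp]: "prob UNIV = 1"
  using prob_space by simp

lemma mem_Lp_two_power_iff:
  "mem_Lp M (2 ^ k) f \<longleftrightarrow> f \<in> borel_measurable M \<and> integrable M (\<lambda>x. \<bar>f x\<bar> ^ 2 ^ k)"
  unfolding mem_Lp_def using two_power_neq_infinity[of k]
  by (simp add: enn2real_two_power powr_two_power)

lemma Lp_norm_two_power: "Lp_norm M (2 ^ k) f = (\<integral>x. \<bar>f x\<bar> ^ 2 ^ k \<partial>M) powr (1 / 2 ^ k)"
  unfolding Lp_norm_def using two_power_neq_infinity[of k]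
  by (simp add: enn2real_two_power powr_two_power)

lemma baire_Lp_imp_mem_Lp: "f \<in> baire_Lp (2 ^ k) \<Longrightarrow> mem_Lp M (2 ^ k) f"
  unfolding mem_Lp_two_power_iff by (auto dest: baire_LpD)

lemma cube_form_const_scale: "cube_form d (\<lambda>_ x. t * f x) = t ^ 2 ^ d * cube_form d (\<lambda>_. f)"
  using cube_form_scale[of d "\<lambda>_. t" "\<lambda>_. f"] by (simp add: card_cube)

text \<open>By homogeneity \<open>f\<close> may be scaled to Gowers norm 1. Where the form vanishes,
  every multiple of \<open>f\<close> is admissible, so the pairing has to vanish too.\<close>

lemma pairing_le_cube_form:
  assumes d: "d \<ge> 1" and g: "gowers_dual_norm M d g \<le> 1" and f: "f \<in> baire_Lp (2 ^ (d - 1))"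
  shows "\<bar>\<integral>x. g x * f x \<partial>M\<bar> ^ 2 ^ d \<le> cube_form d (\<lambda>_. f)"
proof -
  let ?L = "\<lambda>f. \<integral>x. g x * f x \<partial>M" and ?U = "\<lambda>f. cube_form d (\<lambda>_. f)"
  have unit: "\<bar>?L h\<bar> \<le> 1" if h: "h \<in> baire_Lp (2 ^ (d - 1))" "?U h \<le> 1" for h
  proof -
    have "gowers_norm M d h \<le> 1"
      using h by (simp add: gowers_norm_eq_cube_form[OF baire_LpD(1)[OF h(1)]])
    then have "ennreal \<bar>pairing M g h\<bar> \<le> gowers_dual_norm M d g"
      unfolding gowers_dual_norm_def using baire_Lp_imp_mem_Lp[OF h(1)] by (intro SUP_upper) auto
    then have "ennreal \<bar>pairing M g h\<bar> \<le> 1"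
      using g by (rule order.trans)
    then show ?thesis
      by (simp add: pairing_def)
  qed
  have L_scale: "?L (\<lambda>x. t * f x) = t * ?L f" for t
  proof -
    have "?L (\<lambda>x. t * f x) = (\<integral>x. t * (g x * f x) \<partial>M)"
      by (simp add: mult_ac)
    then show ?thesis by simp
  qed
  have U0: "?U f \<ge> 0"
    by (rule cube_form_const_nonneg[OF d f])
  show ?thesis
  proof (cases "?U f = 0")
    case True
    have "\<bar>t * ?L f\<bar> \<le> 1" for t
      using unit[OF baire_Lp_scale[OF f, of t]] True by (simp add: cube_form_const_scale L_scale)
    \<comment> \<open>A nonzero pairing would be scaled to 2, above the bound 1.\<close>
    from this[of "2 / ?L f"] have "?L f = 0"
      by (cases "?L f = 0") auto
    then show ?thesis
      using True by (simp add: power_0_left)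
  next
    case False
    define r where "r = root (2 ^ d) (?U f)"
    have r: "r > 0" "r ^ 2 ^ d = ?U f"
      using U0 False by (auto simp: r_def)
    have "?U (\<lambda>x. (1 / r) * f x) = 1"
      using r False by (simp only: cube_form_const_scale) (simp add: power_one_over)
    then have "\<bar>(1 / r) * ?L f\<bar> \<le> 1"
      using unit[OF baire_Lp_scale[OF f, of "1 / r"]] L_scale[of "1 / r"] by simp
    then have "\<bar>?L f\<bar> \<le> r"
      using r by (simp add: abs_mult field_simps)
    then show ?thesis
      using power_mono[of "\<bar>?L f\<bar>" r "2 ^ d"] r by simp
  qed
qed

text \<open>Young's inequality dominates the product when the exponents are finite. For
  \<open>d - 1 = 0\<close> the conjugate exponent is \<open>1 / 0 = \<infinity>\<close>, and
  \<open>g\<close> is essentially bounded.\<close>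

lemma integrable_pairing:
  assumes g: "mem_Lp M (2 ^ (d - 1) / (2 ^ (d - 1) - 1)) g" and f: "f \<in> baire_Lp (2 ^ (d - 1))"
  shows "integrable M (\<lambda>x. g x * f x)"
proof (cases "d - 1 = 0")
  case True
  then have e: "(2 ^ (d - 1) / (2 ^ (d - 1) - 1) :: ennreal) = \<infinity>"
    by simp
  obtain C where C: "g \<in> borel_measurable M" "AE x in M. \<bar>g x\<bar> \<le> C"
    using g unfolding e mem_Lp_def by auto
  show ?thesis
  proof (rule Bochner_Integration.integrable_bound)
    show "integrable M (\<lambda>x. C * \<bar>f x\<bar>)"
      using baire_LpD(3)[OF f] True by simp
    show "(\<lambda>x. g x * f x) \<in> borel_measurable M"
      using C baire_LpD(2)[OF f] by measurable
    show "AE x in M. norm (g x * f x) \<le> norm (C * \<bar>f x\<bar>)"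
      using C(2)
    proof eventually_elim
      case (elim x)
      then have "\<bar>g x\<bar> * \<bar>f x\<bar> \<le> \<bar>C\<bar> * \<bar>f x\<bar>"
        by (intro mult_right_mono) auto
      then show ?case
        by (simp add: abs_mult)
    qed
  qed
next
  case False
  define P :: real where "P = 2 ^ (d - 1)"
  have P: "P > 1"
    unfolding P_def using False by (intro one_less_power) auto
  have e: "(2 ^ (d - 1) / (2 ^ (d - 1) - 1) :: ennreal) = ennreal (P / (P - 1))"
    unfolding P_def using False by (intro conjugate_exponent) auto
  have g': "g \<in> borel_measurable M" "integrable M (\<lambda>x. \<bar>g x\<bar> powr (P / (P - 1)))"
    using g P unfolding e mem_Lp_def by auto
  show ?thesis
  proof (rule Bochner_Integration.integrable_bound)
    show "integrable M (\<lambda>x. \<bar>g x\<bar> powr (P / (P - 1)) / (P / (P - 1)) + \<bar>f x\<bar> ^ 2 ^ (d - 1) / P)"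
      using g' baire_LpD(3)[OF f] by auto
    show "(\<lambda>x. g x * f x) \<in> borel_measurable M"
      using g' baire_LpD(2)[OF f] by measurable
    show "AE x in M. norm (g x * f x) \<le> norm (\<bar>g x\<bar> powr (P / (P - 1)) / (P / (P - 1)) + \<bar>f x\<bar> ^ 2 ^ (d - 1) / P)"
    proof (intro AE_I2)
      fix x
      have "\<bar>g x\<bar> * \<bar>f x\<bar> \<le> \<bar>g x\<bar> powr (P / (P - 1)) / (P / (P - 1)) + \<bar>f x\<bar> powr P / P"
        using P by (intro Youngs_inequality) (auto simp: field_simps)
      then show "norm (g x * f x) \<le> norm (\<bar>g x\<bar> powr (P / (P - 1)) / (P / (P - 1)) + \<bar>f x\<bar> ^ 2 ^ (d - 1) / P)"
        by (simp add: P_def powr_two_power abs_mult)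
    qed
  qed
qed

lemma const_baire_Lp: "(\<lambda>_. c) \<in> baire_Lp n"
  by (intro baire_Lp_bounded[of _ "\<bar>c\<bar>"]) auto

lemma indicator_baire_Lp: "B \<in> sets baire \<Longrightarrow> indicator B \<in> baire_Lp n"
  by (intro baire_Lp_bounded[of _ 1]) (auto simp: indicator_def)

section \<open>The decomposition\<close>

lemma decomposition_pos:
  assumes d: "d \<ge> 1" and k: "k \<ge> 1" and dk: "d - 1 \<le> k" and \<delta>: "\<delta> > 0"
    and g: "mem_Lp M (2 ^ (d - 1) / (2 ^ (d - 1) - 1)) g" and gd: "gowers_dual_norm M d g \<le> 1"
  shows "\<exists>f h.
    mem_Lp M (2 ^ k) f \<and> mem_Lp M (2 ^ k / (2 ^ k - 1)) h \<and>
    (AE x in M. g x = dual_function M d f x + h x) \<and>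
    Lp_norm M (2 ^ k) f \<le> 1 / \<delta> \<and>
    Lp_norm M (2 ^ k / (2 ^ k - 1)) h \<le> \<delta> \<and>
    gowers_norm M d f \<le> 1"
proof -
  define p :: nat where "p = 2 ^ k"
  \<comment> \<open>With this weight the single bound \<open>c K \<le> 1\<close> on the
    \<open>p\<close>-th moment \<open>K\<close> of \<open>f\<close> yields both Lebesgue estimates,
    the second through
    \<open>c K^((p-1)/p) \<le> \<delta>^p \<delta>^(1-p) = \<delta>\<close>.\<close>
  define c where "c = \<delta> ^ p"
  have p: "p \<ge> 2" "even p" "real p = 2 ^ k"
    using k power_increasing[of 1 k "2 :: nat"] by (auto simp: p_def)
  have c: "c > 0"
    using \<delta> by (simp add: c_def)
  let ?V = "baire_Lp (2 ^ k)" and ?U = "\<lambda>f. cube_form d (\<lambda>_. f)"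
  have sub: "u \<in> baire_Lp (2 ^ (d - 1))" if "u \<in> ?V" for u
    using that baire_Lp_mono[of "2 ^ (d - 1)" "2 ^ k"] dk by (auto intro: power_increasing)
  have g_int: "integrable M (\<lambda>x. g x * u x)" if "u \<in> ?V" for u
    by (rule integrable_pairing[OF g sub[OF that]])
  have g_le: "\<bar>\<integral>x. g x * u x \<partial>M\<bar> ^ 2 ^ d \<le> ?U u" if "u \<in> ?V" for u
    by (rule pairing_le_cube_form[OF d gd sub[OF that]])
  obtain f where f: "f \<in> ?V" and min: "\<And>h. h \<in> ?V \<Longrightarrow> energy d k c g f \<le> energy d k c g h"
    using energy_minimiser_exists[OF d k dk c g_int g_le] by blast
  have fp: "f \<in> baire_Lp p"
    using f by (simp add: p_def)
  let ?D = "dual_function M d f"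
  have critical: "(\<integral>x. u x * ?D x \<partial>M) + c * (\<integral>x. u x * f x ^ (p - 1) \<partial>M) = (\<integral>x. g x * u x \<partial>M)"
    if u: "u \<in> ?V" for u
  proof -
    have up: "u \<in> baire_Lp p"
      using u by (simp add: p_def)
    let ?E = "\<lambda>s. energy d k c g (\<lambda>x. f x + s * u x)"
    have "((\<lambda>s. cube_form d (\<lambda>_ x. f x + s * u x) / 2 ^ d + c / p * (\<integral>x. (f x + s * u x) ^ p \<partial>M)
        - ((\<integral>x. g x * f x \<partial>M) + s * (\<integral>x. g x * u x \<partial>M))) has_real_derivative
      (2 ^ d * (\<integral>x. u x * ?D x \<partial>M)) / 2 ^ d + c / p * (real p * (\<integral>x. u x * f x ^ (p - 1) \<partial>M))
        - (0 + 1 * (\<integral>x. g x * u x \<partial>M))) (at 0)"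
      using p by (intro DERIV_diff DERIV_add DERIV_cdivide DERIV_cmult DERIV_cmult_right DERIV_const DERIV_ident
          DERIV_cube_form DERIV_integral_power d sub f u fp up) auto
    moreover have "?E s = cube_form d (\<lambda>_ x. f x + s * u x) / 2 ^ d + c / p * (\<integral>x. (f x + s * u x) ^ p \<partial>M)
        - ((\<integral>x. g x * f x \<partial>M) + s * (\<integral>x. g x * u x \<partial>M))" for s
    proof -
      have "(\<integral>x. g x * (f x + s * u x) \<partial>M) = (\<integral>x. g x * f x + s * (g x * u x) \<partial>M)"
        by (intro Bochner_Integration.integral_cong) (auto simp: algebra_simps)
      also have "\<dots> = (\<integral>x. g x * f x \<partial>M) + s * (\<integral>x. g x * u x \<partial>M)"
        using g_int[OF f] g_int[OF u] by simp
      finally show ?thesis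
        by (simp add: energy_def p_def)
    qed
    ultimately have "(?E has_real_derivative
        (2 ^ d * (\<integral>x. u x * ?D x \<partial>M)) / 2 ^ d + c / p * (real p * (\<integral>x. u x * f x ^ (p - 1) \<partial>M))
        - (0 + 1 * (\<integral>x. g x * u x \<partial>M))) (at 0)"
      by (simp only:)
    moreover have "\<forall>s. \<bar>0 - s\<bar> < 1 \<longrightarrow> ?E 0 \<le> ?E s"
      using min baire_Lp_add[OF f baire_Lp_scale[OF u]] by simp
    ultimately have "(2 ^ d * (\<integral>x. u x * ?D x \<partial>M)) / 2 ^ d + c / p * (real p * (\<integral>x. u x * f x ^ (p - 1) \<partial>M))
        - (0 + 1 * (\<integral>x. g x * u x \<partial>M)) = 0"
      by (rule DERIV_local_min[OF _ zero_less_one])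
    then show ?thesis
      using p by simp
  qed
  \<comment> \<open>As \<open>p\<close> is even, \<open>p - 1\<close> is odd: the power keeps the
    sign of \<open>f\<close>, and multiplication by \<open>f\<close> gives the \<open>p\<close>-th
    power of its absolute value.\<close>
  define h where "h x = c * f x ^ (p - 1)" for x
  have D_int: "integrable M (\<lambda>x. u x * ?D x)" if "u \<in> ?V" for u
    by (rule integrable_dual_function[OF d sub[OF f] sub[OF that]])
  have fp_int: "integrable M (\<lambda>x. u x * f x ^ (p - 1))" if "u \<in> ?V" for u
    using integrable_power_mult_power[OF fp, of u 1] that p by (simp add: p_def)
  have decomp: "AE x in M. g x - ?D x - h x = 0"
  proof (rule AE_eq_0_if_baire_orthogonal)
    show "integrable M (\<lambda>x. g x - ?D x - h x)"
      using g_int[OF const_baire_Lp[of 1]] D_int[OF const_baire_Lp[of 1]] fp_int[OF const_baire_Lp[of 1]]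
      unfolding h_def by simp
    fix B :: "'a set" assume B: "B \<in> sets baire"
    note V = indicator_baire_Lp[OF B, of "2 ^ k"]
    have "(\<integral>x. (g x - ?D x - h x) * indicator B x \<partial>M) =
        (\<integral>x. g x * indicator B x - indicator B x * ?D x - c * (indicator B x * f x ^ (p - 1)) \<partial>M)"
      by (intro Bochner_Integration.integral_cong) (auto simp: h_def algebra_simps)
    also have "\<dots> = (\<integral>x. g x * indicator B x \<partial>M) - (\<integral>x. indicator B x * ?D x \<partial>M) - c * (\<integral>x. indicator B x * f x ^ (p - 1) \<partial>M)"
      using g_int[OF V] D_int[OF V] fp_int[OF V] by simp
    also have "\<dots> = 0"
      using critical[OF V] by simp
    finally show "(\<integral>x. (g x - ?D x - h x) * indicator B x \<partial>M) = 0" .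
  qed
  define K where "K = (\<integral>x. \<bar>f x\<bar> ^ p \<partial>M)"
  have K0: "K \<ge> 0"
    unfolding K_def by (intro integral_nonneg_AE) auto
  have U0: "?U f \<ge> 0"
    by (rule cube_form_const_nonneg[OF d sub[OF f]])
  have "?U f + c * K \<le> 1" and "?U f \<le> 1"
  proof -
    define l where "l = \<bar>\<integral>x. g x * f x \<partial>M\<bar>"
    have "(\<integral>x. f x * ?D x \<partial>M) = ?U f"
      using integral_dual_function[OF d sub[OF f] sub[OF f]] by simp
    moreover have "(\<integral>x. f x * f x ^ (p - 1) \<partial>M) = K"
      unfolding K_def using p by (intro Bochner_Integration.integral_cong) (auto simp: power_even_abs simp flip: power_Suc)
    ultimately have le: "?U f + c * K \<le> l"
      using critical[OF f] by (simp add: l_def)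
    have "0 \<le> c * K"
      using K0 c by simp
    with g_le[OF f] le have "l ^ 2 ^ d \<le> l"
      unfolding l_def by linarith
    \<comment> \<open>The pairing is bounded above by the \<open>2^d\<close>-th root of
      \<open>?U f\<close> and below by \<open>?U f\<close> itself. Since \<open>2^d > 1\<close>,
      this excludes \<open>l > 1\<close>.\<close>
    have "l \<le> 1"
    proof (rule ccontr)
      assume "\<not> l \<le> 1"
      then have "l ^ 1 < l ^ 2 ^ d"
        using d one_less_power[of "2 :: nat" d] by (intro power_strict_increasing) auto
      with \<open>l ^ 2 ^ d \<le> l\<close> show False by simp
    qed
    with le show "?U f + c * K \<le> 1" by simp
    with \<open>0 \<le> c * K\<close> show "?U f \<le> 1" by linarith
  qed
  then have "c * K \<le> 1"
    using U0 by simp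
  then have K: "K \<le> (1 / \<delta>) ^ p"
    using c \<delta> by (simp add: c_def field_simps)
  have "Lp_norm M (2 ^ k) f = K powr (1 / p)"
    using p by (simp add: Lp_norm_two_power K_def p_def)
  also have "\<dots> \<le> ((1 / \<delta>) ^ p) powr (1 / p)"
    using K K0 by (intro powr_mono2) auto
  also have "\<dots> = 1 / \<delta>"
    using \<delta> p by (simp add: powr_powr flip: powr_realpow)
  finally have norm_f: "Lp_norm M (2 ^ k) f \<le> 1 / \<delta>" .
  \<comment> \<open>The conjugate exponent, for which \<open>(p - 1) q = p\<close>: the
    \<open>q\<close>-th power of \<open>h\<close> is a multiple of the \<open>p\<close>-th power of
    \<open>f\<close>.\<close>
  define q where "q = real p / (real p - 1)"
  have q: "q > 0" "(real p - 1) * q = real p" "1 / q = (real p - 1) / real p"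
    using p(1) by (auto simp: q_def)
  have expo: "(2 ^ k / (2 ^ k - 1) :: ennreal) = ennreal q"
    unfolding q_def p(3) by (rule conjugate_exponent[OF k])
  have hq: "\<bar>h x\<bar> powr q = c powr q * \<bar>f x\<bar> ^ p" for x
  proof -
    have "\<bar>f x ^ (p - 1)\<bar> powr q = \<bar>f x\<bar> ^ p"
    proof (cases "f x = 0")
      case False
      then have "\<bar>f x ^ (p - 1)\<bar> powr q = (\<bar>f x\<bar> powr (real p - 1)) powr q"
        using p by (simp add: power_abs powr_realpow[symmetric] of_nat_diff)
      also have "\<dots> = \<bar>f x\<bar> ^ p"
        using False by (simp only: powr_powr q) (simp add: powr_realpow)
      finally show ?thesis .
    qed (use p(1) q(1) in \<open>auto simp: power_0_left\<close>)
    then show ?thesis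
      using c by (simp add: h_def abs_mult powr_mult)
  qed
  have h_meas: "h \<in> borel_measurable M"
    unfolding h_def[abs_def] using baire_LpD(2)[OF f] by measurable
  have h_mem: "mem_Lp M (2 ^ k / (2 ^ k - 1)) h"
    unfolding expo mem_Lp_def using h_meas q baire_LpD(3)[OF fp] by (simp add: hq)
  have "Lp_norm M (2 ^ k / (2 ^ k - 1)) h = (c powr q * K) powr (1 / q)"
    unfolding expo Lp_norm_def using q by (simp add: hq K_def)
  also have "\<dots> = c * K powr ((real p - 1) / real p)"
    using c K0 q(1) by (simp add: powr_mult powr_powr flip: q(3))
  also have "\<dots> \<le> c * ((1 / \<delta>) ^ p) powr ((real p - 1) / real p)"
    using K K0 c p by (intro mult_left_mono powr_mono2) auto
  also have "\<dots> = \<delta>"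
  proof -
    have "((1 / \<delta>) ^ p) powr ((real p - 1) / real p) = (1 / \<delta>) powr (real p - 1)"
      using \<delta> p by (simp add: powr_powr flip: powr_realpow)
    also have "\<dots> = (1 / \<delta>) ^ (p - 1)"
      using \<delta> p powr_realpow[of "1 / \<delta>" "p - 1"] by (simp add: of_nat_diff)
    finally have "c * ((1 / \<delta>) ^ p) powr ((real p - 1) / real p) = \<delta> ^ p * (1 / \<delta>) ^ (p - 1)"
      by (simp only: c_def)
    moreover have "\<delta> ^ p = \<delta> ^ (p - 1) * \<delta>"
      using p(1) power_minus_mult[of p \<delta>] by simp
    ultimately show ?thesis
      using \<delta> by (simp only:) (simp add: power_one_over)
  qed
  finally have norm_h: "Lp_norm M (2 ^ k / (2 ^ k - 1)) h \<le> \<delta>" .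
  have "gowers_norm M d f \<le> 1"
    using \<open>?U f \<le> 1\<close> by (simp add: gowers_norm_eq_cube_form[OF baire_LpD(1)[OF f]])
  then show ?thesis
    using baire_Lp_imp_mem_Lp[OF f] h_mem norm_f norm_h decomp
    by (intro exI[of _ f] exI[of _ h] conjI) (auto elim!: eventually_mono)
qed

text \<open>At \<open>d = 1\<close> each face is a single vertex, so both factors are the integral
  of \<open>f\<close>. The outer integral runs over a product without coordinates, of total mass
  1.\<close>

lemma cube_form_1_const:
  assumes f: "f \<in> baire_Lp 1"
  shows "cube_form 1 (\<lambda>_. f) = (\<integral>x. f x \<partial>M)\<^sup>2"
proof -
  have "{\<epsilon> \<in> cube 1. \<epsilon> 0 = 0} = {origin 1}"
    unfolding cube_def by (auto simp: PiE_iff extensional_def fun_eq_iff)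
  then have half: "half 1 0 (\<lambda>_. f) x t = f x" for x t
    by (simp only: half_def prod.insert finite.emptyI prod.empty empty_iff not_False_eq_True
        cube_dot_origin add_0_right mult_1_right)
  have "cube_form 1 (\<lambda>_. f) = (\<integral>t. (\<integral>x. half 1 0 (\<lambda>_. f) x t \<partial>M) * (\<integral>x. half 1 0 (\<lambda>_. f) x t \<partial>M) \<partial>(\<Pi>\<^sub>M j\<in>{..<1} - {0}. M))"
    using f by (intro baire_Lp_cube_form_half) auto
  moreover have "measure (\<Pi>\<^sub>M j\<in>{..<1 :: nat} - {0}. M) (space (\<Pi>\<^sub>M j\<in>{..<1} - {0}. M)) = 1"
    by (rule prob_space.prob_space[OF prob_PiM])
  ultimately show ?thesis
    by (simp only: half lebesgue_integral_const) (simp only: power2_eq_square real_scaleR_def mult_1_left)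
qed

text \<open>On level 1 the seminorm is \<open>\<bar>\<integral> f\<bar>\<close>, so anti-uniform functions are constant.\<close>

lemma decomposition_level_1:
  assumes \<delta>: "\<delta> > 0" and g: "mem_Lp M \<infinity> g" and gd: "gowers_dual_norm M 1 g \<le> 1"
  shows "\<exists>f h. mem_Lp M 1 f \<and> mem_Lp M \<infinity> h \<and> (AE x in M. g x = dual_function M 1 f x + h x) \<and>
    Lp_norm M 1 f \<le> 1 / \<delta> \<and> Lp_norm M \<infinity> h \<le> \<delta> \<and> gowers_norm M 1 f \<le> 1"
proof -
  define \<gamma> where "\<gamma> = (\<integral>x. g x \<partial>M)"
  have L: "\<bar>\<integral>x. g x * u x \<partial>M\<bar>\<^sup>2 \<le> (\<integral>x. u x \<partial>M)\<^sup>2" if "u \<in> baire_Lp 1" for u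
    using pairing_le_cube_form[of 1 g u] gd that cube_form_1_const[OF that] by simp
  have int: "integrable M (\<lambda>x. g x * u x)" if "u \<in> baire_Lp 1" for u
    using integrable_pairing[of 1 g u] g that by simp
  have g_int: "integrable M g"
    using int[OF const_baire_Lp[of 1]] by simp
  have \<gamma>1: "\<bar>\<gamma>\<bar> \<le> 1"
    using L[OF const_baire_Lp[of 1]] by (simp add: \<gamma>_def abs_square_le_1)
  have "AE x in M. g x - \<gamma> = 0"
  proof (rule AE_eq_0_if_baire_orthogonal)
    show "integrable M (\<lambda>x. g x - \<gamma>)"
      using g_int by simp
    fix B :: "'a set" assume B: "B \<in> sets baire"
    let ?b = "indicator B :: 'a \<Rightarrow> real" and ?m = "\<integral>x. indicator B x \<partial>M :: real"
    note V = indicator_baire_Lp[OF B, of 1]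
    have b_int: "integrable M ?b"
      using baire_LpD(3)[OF V] by simp
    \<comment> \<open>Subtracting the mean gives a test function of seminorm 0, which the pairing
      must annihilate.\<close>
    have "\<bar>\<integral>x. g x * (?b x - ?m) \<partial>M\<bar>\<^sup>2 \<le> (\<integral>x. ?b x - ?m \<partial>M)\<^sup>2"
      by (intro L baire_Lp_diff V const_baire_Lp)
    also have "(\<integral>x. ?b x - ?m \<partial>M) = 0"
      using b_int by (simp add: prob_space)
    finally have "(\<integral>x. g x * (?b x - ?m) \<partial>M) = 0"
      by simp
    moreover have "(\<integral>x. g x * (?b x - ?m) \<partial>M) = (\<integral>x. g x * ?b x \<partial>M) - \<gamma> * ?m"
      using int[OF V] g_int by (simp add: right_diff_distrib \<gamma>_def)
    moreover have "(\<integral>x. (g x - \<gamma>) * ?b x \<partial>M) = (\<integral>x. g x * ?b x \<partial>M) - \<gamma> * ?m"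
      using int[OF V] b_int by (simp add: left_diff_distrib)
    ultimately show "(\<integral>x. (g x - \<gamma>) * ?b x \<partial>M) = 0"
      by simp
  qed
  then have g_const: "AE x in M. g x = \<gamma>"
    by simp
  \<comment> \<open>The constant \<open>\<gamma>\<close> is split as
    \<open>\<gamma> m + \<gamma> (1 - m)\<close>. For \<open>\<delta> \<le> 1\<close> the remainder
    is 0; for larger \<open>\<delta>\<close> it is at most \<open>1 - m \<le> 1 < \<delta>\<close>,
    while \<open>m = 1 / \<delta>\<close> keeps \<open>f\<close> within its bound.\<close>
  define m where "m = min 1 (1 / \<delta>)"
  have m: "0 \<le> m" "m \<le> 1" "m \<le> 1 / \<delta>"
    using \<delta> by (auto simp: m_def)
  have m\<delta>: "1 - m \<le> \<delta>"
  proof (cases "\<delta> \<le> 1")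
    case True
    then have "m = 1"
      using \<delta> by (simp add: m_def)
    then show ?thesis
      using \<delta> by simp
  qed (use m in simp)
  define f where "f = (\<lambda>_ :: 'a. \<gamma> * m)"
  define h where "h = (\<lambda>_ :: 'a. \<gamma> * (1 - m))"
  have f: "f \<in> baire_Lp 1"
    unfolding f_def by (rule const_baire_Lp)
  have f1: "\<bar>\<gamma> * m\<bar> \<le> m"
    using mult_right_mono[OF \<gamma>1 m(1)] m by (simp add: abs_mult)
  have h1: "\<bar>\<gamma> * (1 - m)\<bar> \<le> 1 - m"
    using mult_right_mono[OF \<gamma>1, of "1 - m"] m by (simp add: abs_mult)
  have "dual_function M 1 f x = \<gamma> * m" for x
  \<comment> \<open>The punctured cube has a single vertex at level 1, so the dual function of a
    constant is the constant itself.\<close>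
  proof -
    have "card (cube_nz 1) = 1"
      unfolding cube_nz_def using origin_cube[of 1] card_cube[of 1] by (simp add: card_Diff_singleton)
    then show ?thesis
      using prob_space.prob_space[OF prob_PiM[of "{..<1 :: nat}"]] dual_function_eq[OF baire_LpD(1)[OF f], of 1 x]
      by (simp add: f_def)
  qed
  then have "AE x in M. g x = dual_function M 1 f x + h x"
    using g_const by (auto simp: h_def algebra_simps)
  moreover have "mem_Lp M 1 f"
    using baire_Lp_imp_mem_Lp[of f 0] f by simp
  moreover have "mem_Lp M \<infinity> h"
    unfolding mem_Lp_def h_def by auto
  moreover have "Lp_norm M 1 f \<le> 1 / \<delta>"
    using Lp_norm_two_power[of 0 f] f1 m by (simp add: f_def prob_space)
  moreover have "Lp_norm M \<infinity> h \<le> \<delta>"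
    using h1 m\<delta> by (simp add: Lp_norm_def h_def esssup_const emeasure_space_1[unfolded space_M])
  moreover have "gowers_norm M 1 f \<le> 1"
  proof -
    have "cube_form 1 (\<lambda>_. f) = (\<gamma> * m)\<^sup>2"
      using cube_form_1_const[OF f] by (simp add: f_def prob_space)
    also have "\<dots> \<le> 1"
      using f1 m by (simp add: abs_square_le_1)
    finally show ?thesis
      by (simp add: gowers_norm_eq_cube_form[OF baire_LpD(1)[OF f]])
  qed
  ultimately show ?thesis
    by blast
qed

end

theorem theorem3p8:
  fixes M :: "'a::{topological_ab_group_add, t2_space} measure"
    and d k :: nat and g :: "'a \<Rightarrow> real" and \<delta> :: real
  assumes "compact (UNIV :: 'a set)"
    and "haar_prob M"
    and "d \<ge> 1"
    and "anti_uniform M d g"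
    and "gowers_dual_norm M d g = 1"
    and "k \<ge> d - 1"
    and "\<delta> > 0"
  shows "\<exists>f h.
    mem_Lp M (2 ^ k) f \<and> mem_Lp M (2 ^ k / (2 ^ k - 1)) h \<and>
    (AE x in M. g x = dual_function M d f x + h x) \<and>
    Lp_norm M (2 ^ k) f \<le> 1 / \<delta> \<and>
    Lp_norm M (2 ^ k / (2 ^ k - 1)) h \<le> \<delta> \<and>
    gowers_norm M d f \<le> 1"
proof -
  interpret compact_haar M
    using assms(1,2) by unfold_locales
  have g: "mem_Lp M (2 ^ (d - 1) / (2 ^ (d - 1) - 1)) g" "gowers_dual_norm M d g \<le> 1"
    using assms(4,5) by (auto simp: anti_uniform_def)
  show ?thesis
  proof (cases "k = 0")
    \<comment> \<open>Here \<open>p = 1\<close> and the conjugate exponent is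
      \<open>\<infinity>\<close>; \<open>k \<ge> d - 1\<close> leaves only level 1, where constants
      suffice.\<close>
    case True
    then have "d = 1"
      using assms(3,6) by simp
    then show ?thesis
      using decomposition_level_1[OF assms(7), of g] g True by simp
  next
    case False
    then show ?thesis
      using decomposition_pos[OF assms(3) _ assms(6,7) g] by simp
  qed
qed

end
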